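(* For a natural number $n$, let $\rho(n)=|\mathcal{X}'_n|/|\mathcal{X}_n|$ be the proportion of Dirichlet characters modulo $n$ that are primitive. Then $$\liminf_{\substack{n\to\infty\\ n\not\equiv 2\ (\mathrm{mod}\ 4)}}\rho(n)\log\log n=C_2\,e^{-\gamma},$$ where $\gamma$ is the Euler--Mascheroni constant and $C_2=\prod_{p>2}\frac{p(p-2)}{(p-1)^2}$ (product over primes $p>2$) is the twin prime constant.
   Context: $\mathcal{X}_n$ is the set of all Dirichlet characters modulo $n$, and $\mathcal{X}'_n\subseteq\mathcal{X}_n$ is the subset of primitive characters (those whose conductor equals $n$). $\gamma=\lim_{n\to\infty}\left(\sum_{m=1}^n \frac1m-\log n\right)$. *)

theory Defs
  imports "HOL-Analysis.Analysis" "HOL-Number_Theory.Number_Theory"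
begin

text \<open>
  Dirichlet characters modulo \<open>n\<close> are taken in the usual extended form, as functions on the
  integers vanishing exactly off the residues coprime to \<open>n\<close>. The normalisation
  \<open>\<eta> 1 = 1\<close> follows from multiplicativity and \<open>\<eta> 1 \<noteq> 0\<close>.
\<close>

definition dirichlet_char :: "nat \<Rightarrow> (int \<Rightarrow> complex) \<Rightarrow> bool" where
  "dirichlet_char n \<eta> \<longleftrightarrow>
     (\<forall>a b. \<eta> (a * b) = \<eta> a * \<eta> b) \<and>
     (\<forall>a. \<eta> (a + int n) = \<eta> a) \<and>
     (\<forall>a. \<eta> a \<noteq> 0 \<longleftrightarrow> coprime a (int n))"

definition dirichlet_chars :: "nat \<Rightarrow> (int \<Rightarrow> complex) set" where
  "dirichlet_chars n = {\<eta>. dirichlet_char n \<eta>}"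

text \<open>
  For \<open>d dvd n\<close>, \<open>induced_from n \<eta> d\<close> says that, as a character of the unit group of the integers
  modulo \<open>n\<close>, \<open>\<eta>\<close> factors through the reduction map to the unit group modulo \<open>d\<close>.
\<close>

definition induced_from :: "nat \<Rightarrow> (int \<Rightarrow> complex) \<Rightarrow> nat \<Rightarrow> bool" where
  "induced_from n \<eta> d \<longleftrightarrow>
     (\<exists>\<psi>\<in>dirichlet_chars d. \<forall>a. coprime a (int n) \<longrightarrow> \<eta> a = \<psi> a)"

definition conductor :: "nat \<Rightarrow> (int \<Rightarrow> complex) \<Rightarrow> nat" where
  "conductor n \<eta> = (LEAST d. d dvd n \<and> induced_from n \<eta> d)"

definition primitive_dirichlet_chars :: "nat \<Rightarrow> (int \<Rightarrow> complex) set" where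
  "primitive_dirichlet_chars n = {\<eta> \<in> dirichlet_chars n. conductor n \<eta> = n}"

definition primitive_proportion :: "nat \<Rightarrow> real" where
  "primitive_proportion n =
     real (card (primitive_dirichlet_chars n)) / real (card (dirichlet_chars n))"

text \<open>
  The Euler product, written as a product over all natural numbers with factor \<open>1\<close> off the
  odd primes.
\<close>

definition twin_prime_const :: real where
  "twin_prime_const =
     (\<Prod>p. if prime p \<and> p > 2 then real p * (real p - 2) / (real p - 1)\<^sup>2 else 1)"

text \<open>
  The cardinalities above are those of finite sets, and the Euler product converges, so neither
  definition silently takes a default value.
\<close>

lemma finite_dirichlet_chars:
  assumes n: "n > 0"
  shows "finite (dirichlet_chars n)"
proof -
  define R where "R = insert 0 {z::complex. z ^ totient n = 1}"
  define F where "F = (\<lambda>\<eta> :: int \<Rightarrow> complex. restrict \<eta> {0..<int n})"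
  have per: "\<eta> (a mod int n) = \<eta> a" if \<eta>: "dirichlet_char n \<eta>" for \<eta> a
  proof -
    have step: "\<eta> (b + int n) = \<eta> b" for b using \<eta> by (simp add: dirichlet_char_def)
    have up: "\<eta> (b + int k * int n) = \<eta> b" for b and k :: nat
    proof (induction k)
      case (Suc k)
      have "\<eta> (b + int (Suc k) * int n) = \<eta> ((b + int k * int n) + int n)"
        by (simp add: algebra_simps)
      with Suc step show ?case by simp
    qed simp
    have "\<eta> (b + k * int n) = \<eta> b" for b k :: int
    proof (cases "k \<ge> 0")
      case True
      then show ?thesis using up[of b "nat k"] by simp
    next
      case False
      then show ?thesis using up[of "b + k * int n" "nat (- k)"] by simp
    qed
    from this[of "a mod int n" "a div int n"] show ?thesis by simp
  qed
  have one: "\<eta> 1 = 1" if "dirichlet_char n \<eta>" for \<eta>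
  proof -
    have "\<eta> (1 * 1) = \<eta> 1 * \<eta> 1" "\<eta> 1 \<noteq> 0"
      using that unfolding dirichlet_char_def by (metis, simp)
    then show ?thesis by simp
  qed
  have pow: "\<eta> (a ^ k) = \<eta> a ^ k" if "dirichlet_char n \<eta>" for \<eta> a k
    using that one[OF that] by (induction k) (simp_all add: dirichlet_char_def)
  have R: "\<eta> a \<in> R" if \<eta>: "dirichlet_char n \<eta>" for \<eta> a
  proof (cases "coprime a (int n)")
    case True
    define m where "m = nat (a mod int n)"
    have m: "int m = a mod int n" using n by (simp add: m_def)
    have "coprime (int m) (int n)" using True n by (simp add: m)
    then have "[m ^ totient n = 1] (mod n)" by (intro euler_theorem) simp
    then have "[int m ^ totient n = 1] (mod int n)"
      using cong_int_iff[of "m ^ totient n" 1 n] by simp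
    then have "\<eta> (int m ^ totient n) = \<eta> 1"
      unfolding cong_def using per[OF \<eta>] by metis
    then have "\<eta> a ^ totient n = 1"
      using pow[OF \<eta>] one[OF \<eta>] per[OF \<eta>] m by metis
    then show ?thesis by (simp add: R_def)
  qed (use \<eta> in \<open>auto simp: R_def dirichlet_char_def\<close>)
  have "finite R" using n by (simp add: R_def finite_roots_unity Suc_le_eq)
  then have fin: "finite (PiE {0..<int n} (\<lambda>_. R))" by (intro finite_PiE) auto
  have "F ` dirichlet_chars n \<subseteq> PiE {0..<int n} (\<lambda>_. R)"
    using R by (auto simp: F_def dirichlet_chars_def)
  then have "finite (F ` dirichlet_chars n)" using fin by (rule finite_subset)
  moreover have "inj_on F (dirichlet_chars n)"
  proof (rule inj_onI, rule ext)
    fix \<eta> \<psi> a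
    assume *: "\<eta> \<in> dirichlet_chars n" "\<psi> \<in> dirichlet_chars n" "F \<eta> = F \<psi>"
    have "\<eta> (a mod int n) = \<psi> (a mod int n)"
      using fun_cong[OF *(3), of "a mod int n"] n by (simp add: F_def)
    moreover have "dirichlet_char n \<eta>" "dirichlet_char n \<psi>"
      using * by (simp_all add: dirichlet_chars_def)
    ultimately show "\<eta> a = \<psi> a" by (metis per)
  qed
  ultimately show ?thesis by (rule finite_imageD)
qed

lemma dirichlet_chars_nonempty: "dirichlet_chars n \<noteq> {}"
proof -
  have "coprime (a + int n) (int n) \<longleftrightarrow> coprime a (int n)" for a
    by (simp add: coprime_iff_gcd_eq_1)
  then have "dirichlet_char n (\<lambda>a. if coprime a (int n) then 1 else 0)"
    by (auto simp: dirichlet_char_def)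
  then show ?thesis by (auto simp: dirichlet_chars_def)
qed

lemma abs_convergent_twin_prime_prod:
  "abs_convergent_prod
     (\<lambda>p. if prime p \<and> p > 2 then real p * (real p - 2) / (real p - 1)\<^sup>2 else 1)"
proof (rule summable_imp_abs_convergent_prod, rule summable_comparison_test', rule summable_mult)
  show "summable (\<lambda>p. inverse (real p ^ 2))" by (rule inverse_power_summable) simp
  fix p :: nat assume "p \<ge> 0"
  have "\<bar>real p * (real p - 2) / (real p - 1)\<^sup>2 - 1\<bar> \<le> 4 * inverse (real p ^ 2)" if "p > 2"
  proof -
    have e: "real p * (real p - 2) / (real p - 1)\<^sup>2 - 1 = - (1 / (real p - 1)\<^sup>2)"
    proof -
      have "(real p - 1)\<^sup>2 \<noteq> 0" using that by simp
      moreover have "real p * (real p - 2) = (real p - 1)\<^sup>2 - 1"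
        by (simp add: power2_eq_square algebra_simps)
      ultimately show ?thesis by (simp add: diff_divide_distrib)
    qed
    have "(real p / 2)\<^sup>2 \<le> (real p - 1)\<^sup>2" using that by (intro power_mono) auto
    then have "1 / (real p - 1)\<^sup>2 \<le> 1 / (real p / 2)\<^sup>2"
      using that by (intro divide_left_mono) auto
    moreover have "1 / (real p / 2)\<^sup>2 = 4 * inverse (real p ^ 2)"
      by (simp add: power_divide inverse_eq_divide)
    ultimately show ?thesis unfolding e abs_minus_cancel by simp
  qed
  then show "norm (norm ((if prime p \<and> p > 2 then real p * (real p - 2) / (real p - 1)\<^sup>2 else 1) - 1))
      \<le> 4 * inverse (real p ^ 2)"
    by auto
qed

end

theory Submission
  imports Defs "HOL-Real_Asymp.Real_Asymp" "HOL-Library.Discrete_Functions"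
begin

text \<open>
  A character modulo \<open>n\<close> is imprimitive iff it factors through \<open>n / p\<close> for some prime
  \<open>p\<close> dividing \<open>n\<close>, and those factoring through \<open>d\<close> number \<open>\<phi>(d)\<close>. Inclusion-exclusion
  gives \<open>\<rho>(n)\<close> as a product over \<open>p\<close> dividing \<open>n\<close>, with factor \<open>1 - 1/(p-1)\<close> if
  \<open>p\<close> divides \<open>n\<close> exactly once and \<open>1 - 1/p\<close> otherwise. When \<open>n\<close> is not \<open>2\<close> modulo \<open>4\<close>,
  this is asymptotically minimised by twice the primorials, where it is \<open>1/2\<close> times the product
  of \<open>1 - 1/(p-1)\<close> over odd \<open>p \<le> x\<close>; dividing by the product of \<open>1 - 1/p\<close> over all
  \<open>p \<le> x\<close> leaves the partial products of \<open>C\<^sub>2\<close>, and the rest is Mertens' third theorem.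

  The constant in Mertens' theorem is found by an Abelian argument. The sum of \<open>1/p\<close> over
  \<open>p \<le> N\<close> is compared with the harmonic number of \<open>\<lfloor>log 2 N\<rfloor>\<close>, the summatory function of
  \<open>1/m\<close> placed at \<open>n = 2\<^sup>m\<close>. The difference converges, and its limit can be read off
  from the Dirichlet series as \<open>s\<close> tends to \<open>0\<close>, where both \<open>ln \<zeta>(1+s)\<close> and
  \<open>-ln(1 - 2 powr -s)\<close> are \<open>-ln s + O(1)\<close>.
\<close>

section \<open>Counting Dirichlet characters\<close>

text \<open>The value 0 off \<open>K\<close> makes each character of \<open>K\<close> one definite
  function on the whole type, so that characters can be counted as a set of functions. It agrees
  with the extended form of Dirichlet characters.\<close>

definition characters_on :: "('a, 'b) monoid_scheme \<Rightarrow> 'a set \<Rightarrow> ('a \<Rightarrow> complex) set" where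
  "characters_on G K =
     {\<omega>. (\<forall>a\<in>K. \<forall>b\<in>K. \<omega> (a \<otimes>\<^bsub>G\<^esub> b) = \<omega> a * \<omega> b) \<and> (\<forall>a. \<omega> a \<noteq> 0 \<longleftrightarrow> a \<in> K)}"

lemma characters_on_mult:
  "\<omega> \<in> characters_on G K \<Longrightarrow> a \<in> K \<Longrightarrow> b \<in> K \<Longrightarrow> \<omega> (a \<otimes>\<^bsub>G\<^esub> b) = \<omega> a * \<omega> b"
  by (simp add: characters_on_def)

lemma characters_on_nonzero_iff: "\<omega> \<in> characters_on G K \<Longrightarrow> \<omega> a \<noteq> 0 \<longleftrightarrow> a \<in> K"
  by (simp add: characters_on_def)

lemma (in group) characters_on_one:
  assumes "\<omega> \<in> characters_on G K" "subgroup K G"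
  shows "\<omega> \<one> = 1"
proof -
  have 1: "\<one> \<in> K" using assms(2) by (rule subgroup.one_closed)
  have "\<omega> \<one> = \<omega> \<one> * \<omega> \<one>" using characters_on_mult[OF assms(1) 1 1] by simp
  then show ?thesis using characters_on_nonzero_iff[OF assms(1)] 1 by auto
qed

lemma (in group) characters_on_pow:
  assumes "\<omega> \<in> characters_on G K" "subgroup K G" "a \<in> K"
  shows "\<omega> (a [^] (i::nat)) = \<omega> a ^ i"
proof (induction i)
  case 0
  then show ?case using characters_on_one[OF assms(1,2)] by simp
next
  case (Suc i)
  have "a [^] i \<in> K" using assms(2,3)
    by (induction i) (auto intro: subgroup.one_closed subgroup.m_closed)
  then show ?case using Suc characters_on_mult[OF assms(1) _ assms(3)] by simp
qed

text \<open>
  If \<open>x\<close> has order \<open>m\<close> modulo \<open>K\<close>, a character of \<open>K\<close> extends to the subgroup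
  generated by \<open>K\<close> and \<open>x\<close> in exactly \<open>m\<close> ways, one for each \<open>m\<close>-th root of its value
  at \<open>x [^] m\<close>.
\<close>
lemma (in comm_group) extend_subgroup_card_characters:
  assumes fin: "finite (carrier G)" and K: "subgroup K G"
    and x: "x \<in> carrier G" "x \<notin> K" and cK: "card (characters_on G K) = card K"
  obtains K' where "subgroup K' G" "K \<subset> K'" "card (characters_on G K') = card K'"
proof -
  interpret K: subgroup K G by fact
  have K0: "K \<noteq> {}" using K.one_closed by blast
  define m where "m = (LEAST m::nat. m > 0 \<and> x [^] m \<in> K)"
  have "ord x > 0 \<and> x [^] ord x \<in> K" using ord_ge_1[OF fin x(1)] pow_ord_eq_1[OF x(1)] by simp
  then have m: "m > 0" "x [^] m \<in> K" unfolding m_def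
    by (metis (mono_tags, lifting) LeastI_ex)+
  have least: "x [^] i \<notin> K" if "0 < i" "i < m" for i :: nat
    using not_less_Least[of i "\<lambda>m. m > 0 \<and> x [^] m \<in> K"] that by (auto simp: m_def)
  have m1: "m > 1" using m x by (cases "m = 1") auto
  define \<phi> where "\<phi> = (\<lambda>(k, i::nat). k \<otimes> x [^] i)"
  define K' where "K' = \<phi> ` (K \<times> {..<m})"
  have KG: "k \<in> carrier G" if "k \<in> K" for k using that by (rule K.mem_carrier)
  have inj_aux: "k = l \<and> i = j"
    if "k \<in> K" "l \<in> K" "i \<le> j" "j < m" "k \<otimes> x [^] i = l \<otimes> x [^] j" for k l and i j :: nat
  proof -
    have "l \<otimes> x [^] j = (l \<otimes> x [^] (j - i)) \<otimes> x [^] i"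
      using that x KG by (simp add: m_assoc nat_pow_mult)
    then have "k = l \<otimes> x [^] (j - i)" using that x KG
      by (metis m_closed nat_pow_closed right_cancel)
    then have "x [^] (j - i) = inv l \<otimes> k"
      using that x KG by (simp add: inv_solve_left)
    then have "x [^] (j - i) \<in> K" using that by auto
    then have "j - i = 0" using least[of "j - i"] that by linarith
    then show ?thesis using that x KG \<open>k = l \<otimes> x [^] (j - i)\<close> by auto
  qed
  have inj: "inj_on \<phi> (K \<times> {..<m})"
  proof (rule inj_onI, clarsimp simp: \<phi>_def)
    fix k l and i j :: nat
    assume *: "k \<in> K" "i < m" "l \<in> K" "j < m" "k \<otimes> x [^] i = l \<otimes> x [^] j"
    show "k = l \<and> i = j"
      using inj_aux[of k l i j] inj_aux[of l k j i] * by (cases "i \<le> j") auto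
  qed
  \<comment> \<open>Adding two exponents below \<open>m\<close> may overflow. \<open>c\<close>
    returns the carry, \<open>\<one>\<close> or \<open>x [^] m\<close>, which lies in
    \<open>K\<close>, together with the reduced exponent.\<close>
  define c where "c = (\<lambda>i j. if i + j < m then (\<one>, i + j) else (x [^] m, i + j - m))"
  have prod: "\<phi> (k, i) \<otimes> \<phi> (l, j) = \<phi> (k \<otimes> l \<otimes> fst (c i j), snd (c i j))"
    if "k \<in> K" "l \<in> K" for k l i j
  proof -
    have "\<phi> (k, i) \<otimes> \<phi> (l, j) = k \<otimes> l \<otimes> x [^] (i + j)"
      using that x KG by (simp add: \<phi>_def m_ac nat_pow_mult [symmetric])
    also have "\<dots> = k \<otimes> l \<otimes> (fst (c i j) \<otimes> x [^] snd (c i j))"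
      using x by (auto simp: c_def nat_pow_mult)
    finally show ?thesis using that x KG m by (auto simp: \<phi>_def c_def m_assoc)
  qed
  have c: "fst (c i j) \<in> K" "i < m \<Longrightarrow> j < m \<Longrightarrow> snd (c i j) < m" for i j
    using m by (auto simp: c_def)
  have \<phi>K': "\<phi> (k, i) \<in> K'" if "k \<in> K" "i < m" for k i using that by (auto simp: K'_def)
  have KK': "K \<subseteq> K'"
  proof
    fix k assume "k \<in> K"
    then have "k = \<phi> (k, 0)" using KG by (simp add: \<phi>_def)
    then show "k \<in> K'" using \<phi>K'[OF \<open>k \<in> K\<close> m(1)] by simp
  qed
  have "\<phi> (\<one>, 1) = x" using x by (simp add: \<phi>_def)
  then have xK': "x \<in> K'" using \<phi>K'[of \<one> 1] m1 by auto
  have sub: "subgroup K' G"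
  proof (rule subgroupI)
    show "K' \<subseteq> carrier G" using x KG by (auto simp: K'_def \<phi>_def)
    show "K' \<noteq> {}" using xK' by auto
    fix a assume "a \<in> K'"
    then obtain k i where a: "a = \<phi> (k, i)" "k \<in> K" "i < m" by (auto simp: K'_def)
    show "inv a \<in> K'"
    proof (cases "i = 0")
      case True
      then have "inv a = \<phi> (inv k, 0)" using a KG by (simp add: \<phi>_def)
      then show ?thesis using a m \<phi>K' by simp
    next
      case False
      \<comment> \<open>The exponent \<open>-i\<close> is brought back into range by adding
        \<open>m\<close>, which the factor \<open>inv (x [^] m)\<close> from \<open>K\<close>
        compensates.\<close>
      have "a \<otimes> \<phi> (inv k \<otimes> inv (x [^] m), m - i) = (k \<otimes> inv k) \<otimes> (x [^] i \<otimes> x [^] (m - i) \<otimes> inv (x [^] m))"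
      proof -
        have "a' \<otimes> b \<otimes> (c \<otimes> d \<otimes> e) = (a' \<otimes> c) \<otimes> (b \<otimes> e \<otimes> d)"
          if "a' \<in> carrier G" "b \<in> carrier G" "c \<in> carrier G" "d \<in> carrier G" "e \<in> carrier G"
          for a' b c d e using that by (simp add: m_ac)
        then show ?thesis using a x KG by (simp add: \<phi>_def)
      qed
      also have "\<dots> = \<one>" using a x KG by (simp add: nat_pow_mult)
      finally have "inv a = \<phi> (inv k \<otimes> inv (x [^] m), m - i)"
        using a x KG by (intro inv_equality) (auto simp: \<phi>_def m_comm)
      then show ?thesis using a m False \<phi>K' by auto
    qed
    fix b assume "b \<in> K'"
    then obtain l j where b: "b = \<phi> (l, j)" "l \<in> K" "j < m" by (auto simp: K'_def)
    show "a \<otimes> b \<in> K'" unfolding a(1) b(1) prod[OF a(2) b(2)]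
      using a b c by (intro \<phi>K') auto
  qed
  have cardK': "card K' = card K * m"
    unfolding K'_def by (subst card_image[OF inj]) (simp add: card_cartesian_product)
  \<comment> \<open>An extension is recorded by its restriction to \<open>K\<close> and its value at
    \<open>x\<close>; the latter must be an \<open>m\<close>-th root of the value already prescribed
    at \<open>x [^] m\<close>.\<close>
  define S where "S = (SIGMA \<omega>:characters_on G K. {z. z ^ m = \<omega> (x [^] m)})"
  define F where "F = (\<lambda>\<omega>'. (\<lambda>a. if a \<in> K then \<omega>' a else (0::complex), \<omega>' x))"
  have char_\<phi>: "\<omega> (\<phi> (k, i)) = \<omega> k * \<omega> x ^ i"
    if "\<omega> \<in> characters_on G K'" "k \<in> K" "i < m" for \<omega> k i
  proof -
    have "x [^] i \<in> K'" using \<phi>K'[of \<one> i] that x by (simp add: \<phi>_def)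
    then show ?thesis using that characters_on_mult[OF that(1), of k "x [^] i"] KK'
        characters_on_pow[OF that(1) sub xK'] by (auto simp: \<phi>_def)
  qed
  have "bij_betw F (characters_on G K') S"
    unfolding bij_betw_def
  proof (intro conjI equalityI subsetI)
    show "inj_on F (characters_on G K')"
    proof (rule inj_onI, rule ext)
      fix \<omega> \<psi> a assume *: "\<omega> \<in> characters_on G K'" "\<psi> \<in> characters_on G K'" "F \<omega> = F \<psi>"
      have e: "\<omega> k = \<psi> k" if "k \<in> K" for k
      proof -
        have "fst (F \<omega>) k = fst (F \<psi>) k" using * by simp
        then show ?thesis using that by (simp add: F_def)
      qed
      have e2: "\<omega> x = \<psi> x" using * by (simp add: F_def)
      show "\<omega> a = \<psi> a"
      proof (cases "a \<in> K'")
        case True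
        then obtain k i where "a = \<phi> (k, i)" "k \<in> K" "i < m" by (auto simp: K'_def)
        then show ?thesis using char_\<phi>[OF *(1)] char_\<phi>[OF *(2)] e e2 by simp
      next
        case False
        then show ?thesis using characters_on_nonzero_iff * by metis
      qed
    qed
  next
    fix y assume "y \<in> F ` characters_on G K'"
    then obtain \<omega> where \<omega>: "\<omega> \<in> characters_on G K'" "y = F \<omega>" by auto
    have "(\<lambda>a. if a \<in> K then \<omega> a else 0) \<in> characters_on G K"
      using \<omega> KK' by (auto simp: characters_on_def)
    moreover have "\<omega> x ^ m = \<omega> (x [^] m)" using characters_on_pow[OF \<omega>(1) sub xK'] by simp
    ultimately show "y \<in> S" using m by (simp add: \<omega>(2) S_def F_def)
  next
    fix y assume "y \<in> S"
    then obtain \<omega> z where y: "y = (\<omega>, z)" "\<omega> \<in> characters_on G K" "z ^ m = \<omega> (x [^] m)"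
      by (auto simp: S_def)
    have z: "z \<noteq> 0" using y(3) m characters_on_nonzero_iff[OF y(2), of "x [^] m"]
      by (auto simp: power_0_left)
    define \<omega>' where "\<omega>' = (\<lambda>a. if a \<in> K' then
       (case inv_into (K \<times> {..<m}) \<phi> a of (k, i) \<Rightarrow> \<omega> k * z ^ i) else 0)"
    have \<omega>': "\<omega>' (\<phi> (k, i)) = \<omega> k * z ^ i" if "k \<in> K" "i < m" for k i
      using that \<phi>K' inv_into_f_f[OF inj, of "(k, i)"] by (simp add: \<omega>'_def)
    \<comment> \<open>The condition on \<open>z\<close> is exactly what makes the carry compatible
      with multiplication.\<close>
    have cc: "\<omega> (fst (c i j)) * z ^ snd (c i j) = z ^ (i + j)" for i j
      using characters_on_one[OF y(2) K] y(3)
      by (auto simp: c_def power_add [symmetric] simp flip: y(3))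
    have "\<omega>' \<in> characters_on G K'" unfolding characters_on_def
    proof (intro CollectI conjI ballI allI)
      fix a b assume ab: "a \<in> K'" "b \<in> K'"
      obtain k i where a: "a = \<phi> (k, i)" "k \<in> K" "i < m" using ab by (auto simp: K'_def)
      obtain l j where b: "b = \<phi> (l, j)" "l \<in> K" "j < m" using ab by (auto simp: K'_def)
      have "\<omega>' (a \<otimes> b) = \<omega> (k \<otimes> l \<otimes> fst (c i j)) * z ^ snd (c i j)"
        unfolding a(1) b(1) prod[OF a(2) b(2)] using a b c by (intro \<omega>') auto
      also have "\<dots> = \<omega> k * \<omega> l * z ^ (i + j)"
        using a b c by (simp add: characters_on_mult[OF y(2)] mult.assoc cc)
      finally show "\<omega>' (a \<otimes> b) = \<omega>' a * \<omega>' b"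
        using a b by (simp add: \<omega>' power_add)
    next
      fix a
      show "\<omega>' a \<noteq> 0 \<longleftrightarrow> a \<in> K'"
      proof (cases "a \<in> K'")
        case True
        then obtain k i where "a = \<phi> (k, i)" "k \<in> K" "i < m" by (auto simp: K'_def)
        then show ?thesis using \<omega>' z True characters_on_nonzero_iff[OF y(2), of k] by simp
      qed (simp add: \<omega>'_def)
    qed
    moreover have "F \<omega>' = y"
    proof -
      have "\<omega>' k = \<omega> k" if "k \<in> K" for k
        using \<omega>'[OF that m(1)] KG[OF that] by (simp add: \<phi>_def)
      moreover have "\<omega> k = 0" if "k \<notin> K" for k
        using that characters_on_nonzero_iff[OF y(2), of k] by auto
      moreover have "\<omega>' x = z" using \<omega>'[of \<one> 1] m1 x characters_on_one[OF y(2) K]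
        by (simp add: \<phi>_def)
      ultimately show ?thesis by (auto simp: F_def y(1))
    qed
    ultimately show "y \<in> F ` characters_on G K'" by blast
  qed
  then have "card (characters_on G K') = card S" by (rule bij_betw_same_card)
  also have "card S = card K * m"
  proof -
    have "finite K" using fin K.subset by (rule finite_subset [rotated])
    then have "card K > 0" using K0 by (simp add: card_gt_0_iff)
    then have "finite (characters_on G K)" using cK by (intro card_ge_0_finite) simp
    \<comment> \<open>The prescribed value is nonzero, so it has exactly \<open>m\<close> complex
      \<open>m\<close>-th roots.\<close>
    moreover have "finite {z. z ^ m = \<omega> (x [^] m)} \<and> card {z. z ^ m = \<omega> (x [^] m)} = m"
      if "\<omega> \<in> characters_on G K" for \<omega>
    proof -
      have "\<omega> (x [^] m) \<noteq> 0" using characters_on_nonzero_iff[OF that] m by simp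
      then show ?thesis using m by (auto intro: card_nth_roots)
    qed
    ultimately show ?thesis unfolding S_def using cK by (subst card_SigmaI) auto
  qed
  finally have "card (characters_on G K') = card K'" using cardK' by simp
  moreover have "K \<subset> K'" using KK' xK' x by blast
  ultimately show ?thesis using that sub by blast
qed

text \<open>Among the subgroups with as many characters as elements a maximal one exists by
  finiteness, and it must be the whole group, since otherwise it could be extended by one more
  element.\<close>

theorem (in comm_group) card_characters_on_carrier:
  assumes fin: "finite (carrier G)"
  shows "card (characters_on G (carrier G)) = order G"
proof -
  define M where "M = {K. subgroup K G \<and> card (characters_on G K) = card K}"
  have "M \<subseteq> Pow (carrier G)" by (auto simp: M_def dest: subgroup.subset)
  then have finM: "finite M" using fin finite_subset by blast
  have "{\<one>} \<in> M"
  proof -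
    have "characters_on G {\<one>} = {\<lambda>a. if a = \<one> then 1 else 0}"
    proof (intro equalityI subsetI)
      fix \<omega> assume \<omega>: "\<omega> \<in> characters_on G {\<one>}"
      then have "\<omega> a = (if a = \<one> then 1 else 0)" for a
        using characters_on_one[OF \<omega> triv_subgroup] characters_on_nonzero_iff[OF \<omega>, of a] by auto
      then show "\<omega> \<in> {\<lambda>a. if a = \<one> then 1 else 0}" by auto
    qed (auto simp: characters_on_def)
    then show ?thesis by (simp add: M_def triv_subgroup)
  qed
  then obtain K where K: "K \<in> M" "\<And>K'. K' \<in> M \<Longrightarrow> K \<subseteq> K' \<Longrightarrow> K = K'"
    using finite_has_maximal[OF finM] by blast
  have "carrier G \<subseteq> K"
  proof
    fix x assume x: "x \<in> carrier G"
    show "x \<in> K"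
    proof (rule ccontr)
      assume nx: "x \<notin> K"
      obtain K' where "subgroup K' G" "K \<subset> K'" "card (characters_on G K') = card K'"
        using extend_subgroup_card_characters[OF fin _ x nx] K(1) by (auto simp: M_def)
      then show False using K(2)[of K'] by (auto simp: M_def)
    qed
  qed
  then have "K = carrier G" using K(1) by (auto simp: M_def dest: subgroup.subset)
  then show ?thesis using K(1) by (simp add: M_def order_def)
qed

section \<open>Dirichlet characters as characters of the unit group\<close>

lemma dirichlet_char_mult: "dirichlet_char n \<eta> \<Longrightarrow> \<eta> (a * b) = \<eta> a * \<eta> b"
  by (simp add: dirichlet_char_def)

lemma dirichlet_char_nonzero_iff: "dirichlet_char n \<eta> \<Longrightarrow> \<eta> a \<noteq> 0 \<longleftrightarrow> coprime a (int n)"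
  by (simp add: dirichlet_char_def)

lemma dirichlet_char_one: "dirichlet_char n \<eta> \<Longrightarrow> \<eta> 1 = 1"
  using dirichlet_char_mult[of n \<eta> 1 1] dirichlet_char_nonzero_iff[of n \<eta> 1] by auto

lemma dirichlet_char_cong:
  assumes \<eta>: "dirichlet_char n \<eta>" and "[a = b] (mod int n)"
  shows "\<eta> a = \<eta> b"
proof -
  have up: "\<eta> (b + int k * int n) = \<eta> b" for b and k :: nat
  proof (induction k)
    case (Suc k)
    have "\<eta> (b + int (Suc k) * int n) = \<eta> ((b + int k * int n) + int n)"
      by (simp add: algebra_simps)
    with Suc \<eta> show ?case by (simp add: dirichlet_char_def)
  qed simp
  obtain k where k: "b = a + int n * k" using assms(2) by (auto simp: cong_iff_lin)
  show ?thesis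
  proof (cases "k \<ge> 0")
    case True
    then show ?thesis using up[of a "nat k"] k by (simp add: mult.commute)
  next
    case False
    then show ?thesis using up[of b "nat (- k)"] k by (simp add: mult.commute)
  qed
qed

text \<open>Composition with reduction modulo \<open>n\<close> is a bijection from the characters of
  the unit group of the residue ring onto the Dirichlet characters modulo \<open>n\<close>.\<close>

theorem card_dirichlet_chars:
  assumes n: "n > 0"
  shows "card (dirichlet_chars n) = totient n"
proof (cases "n = 1")
  case True
  have "\<eta> \<in> dirichlet_chars 1 \<longleftrightarrow> \<eta> = (\<lambda>_. 1)" for \<eta>
  proof
    assume "\<eta> \<in> dirichlet_chars 1"
    then have \<eta>: "dirichlet_char 1 \<eta>" by (simp add: dirichlet_chars_def)
    show "\<eta> = (\<lambda>_. 1)"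
    proof
      fix a
      have "\<eta> a = \<eta> 1" by (intro dirichlet_char_cong[OF \<eta>]) simp
      then show "\<eta> a = 1" using dirichlet_char_one[OF \<eta>] by simp
    qed
  qed (auto simp: dirichlet_chars_def dirichlet_char_def)
  then have "dirichlet_chars 1 = {\<lambda>_. 1}" by blast
  then show ?thesis using True by simp
next
  case False
  define R where "R = residue_ring (int n)"
  \<comment> \<open>The locale \<open>residues\<close> asks for a modulus above 1, hence the
    separate case \<open>n = 1\<close>.\<close>
  interpret residues "int n" R using n False by unfold_locales (auto simp: R_def)
  define G where "G = units_of R"
  interpret G: comm_group G unfolding G_def by (rule units_comm_group)
  have carr: "carrier G = Units R" by (simp add: G_def units_of_carrier)
  have mult: "a \<otimes>\<^bsub>G\<^esub> b = a * b mod int n" for a b by (simp add: G_def units_of_mult res_mult_eq)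
  have unit: "a mod int n \<in> Units R \<longleftrightarrow> coprime a (int n)" for a
  proof -
    have "coprime a (int n)" if "coprime (a mod int n) (int n)" using that n by simp
    then show ?thesis using mod_in_res_units[of a] n False by (auto simp: res_units_eq)
  qed
  define F where "F = (\<lambda>\<omega> :: int \<Rightarrow> complex. \<lambda>a. \<omega> (a mod int n))"
  have modid: "a mod int n = a" if "a \<in> Units R" for a using that by (simp add: res_units_eq)
  have "bij_betw F (characters_on G (carrier G)) (dirichlet_chars n)"
    unfolding bij_betw_def
  proof (intro conjI equalityI subsetI)
    show "inj_on F (characters_on G (carrier G))"
    proof (rule inj_onI, rule ext)
      fix \<omega> \<psi> a
      assume *: "\<omega> \<in> characters_on G (carrier G)" "\<psi> \<in> characters_on G (carrier G)" "F \<omega> = F \<psi>"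
      show "\<omega> a = \<psi> a"
      proof (cases "a \<in> Units R")
        case True
        then show ?thesis using fun_cong[OF *(3), of a] modid[OF True] by (simp add: F_def)
      next
        case False
        then show ?thesis using * characters_on_nonzero_iff carr by metis
      qed
    qed
  next
    fix \<eta> assume "\<eta> \<in> F ` characters_on G (carrier G)"
    then obtain \<omega> where \<omega>: "\<omega> \<in> characters_on G (carrier G)" "\<eta> = F \<omega>" by auto
    have nz: "\<eta> a \<noteq> 0 \<longleftrightarrow> coprime a (int n)" for a
      using characters_on_nonzero_iff[OF \<omega>(1)] unit[of a] carr by (simp add: \<omega>(2) F_def)
    have "\<eta> (a * b) = \<eta> a * \<eta> b" for a b
    proof (cases "coprime a (int n) \<and> coprime b (int n)")
      case True
      then have "\<omega> ((a mod int n) \<otimes>\<^bsub>G\<^esub> (b mod int n)) = \<eta> a * \<eta> b"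
        unfolding \<omega>(2) F_def by (intro characters_on_mult[OF \<omega>(1)]) (auto simp: carr unit)
      then show ?thesis by (simp add: mult \<omega>(2) F_def mod_mult_eq)
    next
      case False
      then have "\<not> coprime (a * b) (int n)" by auto
      then show ?thesis using False nz by (metis mult_eq_0_iff)
    qed
    then show "\<eta> \<in> dirichlet_chars n"
      using nz by (simp add: dirichlet_chars_def dirichlet_char_def \<omega>(2) F_def)
  next
    fix \<eta> assume "\<eta> \<in> dirichlet_chars n"
    then have \<eta>: "dirichlet_char n \<eta>" by (simp add: dirichlet_chars_def)
    define \<omega> where "\<omega> = (\<lambda>a. if a \<in> Units R then \<eta> a else 0)"
    have "\<omega> \<in> characters_on G (carrier G)" unfolding characters_on_def
    proof (intro CollectI conjI ballI allI)
      fix a b assume ab: "a \<in> carrier G" "b \<in> carrier G"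
      then have "a \<otimes>\<^bsub>G\<^esub> b \<in> carrier G" by (rule G.m_closed)
      then have "\<omega> (a \<otimes>\<^bsub>G\<^esub> b) = \<eta> (a * b mod int n)" by (simp add: \<omega>_def carr mult)
      also have "\<dots> = \<eta> (a * b)" by (intro dirichlet_char_cong[OF \<eta>]) simp
      finally show "\<omega> (a \<otimes>\<^bsub>G\<^esub> b) = \<omega> a * \<omega> b"
        using ab by (simp add: \<omega>_def carr dirichlet_char_mult[OF \<eta>])
    next
      fix a show "\<omega> a \<noteq> 0 \<longleftrightarrow> a \<in> carrier G"
        using unit[of a] modid[of a] dirichlet_char_nonzero_iff[OF \<eta>, of a]
        by (auto simp: \<omega>_def carr)
    qed
    moreover have "F \<omega> = \<eta>"
    proof
      fix a
      have "\<eta> (a mod int n) = \<eta> a" by (intro dirichlet_char_cong[OF \<eta>]) simp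
      then show "F \<omega> a = \<eta> a"
        using unit[of a] dirichlet_char_nonzero_iff[OF \<eta>, of a] by (auto simp: F_def \<omega>_def)
    qed
    ultimately show "\<eta> \<in> F ` characters_on G (carrier G)" by blast
  qed
  then have "card (dirichlet_chars n) = card (characters_on G (carrier G))"
    using bij_betw_same_card by fastforce
  also have "\<dots> = order G" by (rule G.card_characters_on_carrier) (simp add: carr)
  also have "\<dots> = totient n" using totient_eq by (simp add: order_def carr)
  finally show ?thesis .
qed

section \<open>The proportion of primitive characters\<close>

text \<open>Units modulo \<open>d\<close> lift to units modulo \<open>n\<close>. With
  \<open>t\<close> the product of the primes dividing \<open>n\<close> but not \<open>a\<close>,
  each prime factor of \<open>n\<close> divides exactly one of \<open>a\<close> and
  \<open>d * t\<close>, hence not the lift \<open>a + d * t\<close>.\<close>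

lemma ex_coprime_lift:
  fixes a :: int
  assumes n: "n > 0" and d: "d dvd n" and a: "coprime a (int d)"
  obtains b where "[b = a] (mod int d)" "coprime b (int n)"
proof -
  define T where "T = {p. prime p \<and> p dvd n \<and> \<not> int p dvd a}"
  have "T \<subseteq> {..n}" using n by (auto simp: T_def dvd_imp_le)
  then have T: "finite T" by (rule finite_subset) simp
  define t where "t = \<Prod>T"
  define b where "b = a + int d * int t"
  have "coprime b (int n)"
  proof (rule ccontr)
    assume "\<not> coprime b (int n)"
    then have "\<not> is_unit (gcd b (int n))" unfolding is_unit_gcd .
    moreover have "gcd b (int n) \<noteq> 0" using n by simp
    ultimately obtain q where "prime q" "q dvd gcd b (int n)"
      using prime_divisorE by metis
    then have q: "prime q" "q dvd b" "q dvd int n" by simp_all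
    define p where "p = nat q"
    have qp: "q = int p" using prime_ge_0_int[OF q(1)] by (simp add: p_def)
    then have p: "prime p" "q = int p" using q(1) by simp_all
    have pn: "p dvd n" using q p by simp
    show False
    proof (cases "q dvd a")
      case True
      then have "p \<notin> T" "\<not> q dvd int d"
        using p a q(1) by (auto simp: T_def dest: coprime_common_divisor)
      have "q dvd int d * int t" using True q(2) by (simp add: b_def dvd_add_right_iff)
      then have "p dvd t" using \<open>\<not> q dvd int d\<close> q(1) p by (simp add: prime_dvd_mult_iff)
      then obtain p' where "p' \<in> T" "p dvd p'" using T p(1) by (auto simp: t_def prime_dvd_prod_iff)
      then have "p = p'" using p(1) by (auto simp: T_def primes_dvd_imp_eq)
      then show False using \<open>p' \<in> T\<close> \<open>p \<notin> T\<close> by simp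
    next
      case False
      then have "p \<in> T" using p pn by (simp add: T_def)
      then have "p dvd t" using T unfolding t_def by (intro dvd_prodI) auto
      then have "q dvd int d * int t" using p by simp
      then have "q dvd a" using q(2) by (simp add: b_def dvd_add_left_iff)
      then show False using False by simp
    qed
  qed
  moreover have "[b = a] (mod int d)" by (simp add: b_def cong_def)
  ultimately show ?thesis using that by blast
qed

lemma coprime_int_dvd: "coprime a (int n) \<Longrightarrow> d dvd n \<Longrightarrow> coprime a (int d)"
  by (rule coprime_divisors[of a a "int d" "int n"]) simp_all

lemma cong_coprime_int: "[a = b] (mod m) \<Longrightarrow> coprime a m \<longleftrightarrow> coprime b (m::int)"
  using cong_imp_coprime[of a b m] cong_imp_coprime[of b a m] cong_sym[of a b m] by blast

lemma div_dvd_self_nat: "d dvd n \<Longrightarrow> n div d dvd (n::nat)"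
  by (metis dvd_div_mult_self dvd_triv_left)

text \<open>A character of the units modulo \<open>n\<close> factors through the units modulo
  \<open>d\<close> iff it is trivial on the kernel of the reduction map, because that map is
  surjective.\<close>

lemma induced_from_iff:
  assumes n: "n > 0" and d: "d dvd n" and \<eta>: "dirichlet_char n \<eta>"
  shows "induced_from n \<eta> d \<longleftrightarrow> (\<forall>a. coprime a (int n) \<longrightarrow> [a = 1] (mod int d) \<longrightarrow> \<eta> a = 1)"
proof
  assume "induced_from n \<eta> d"
  then obtain \<psi> where \<psi>: "dirichlet_char d \<psi>" "\<And>a. coprime a (int n) \<Longrightarrow> \<eta> a = \<psi> a"
    by (auto simp: induced_from_def dirichlet_chars_def)
  show "\<forall>a. coprime a (int n) \<longrightarrow> [a = 1] (mod int d) \<longrightarrow> \<eta> a = 1"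
    using \<psi>(2) dirichlet_char_cong[OF \<psi>(1), of _ 1] dirichlet_char_one[OF \<psi>(1)] by auto
next
  assume *: "\<forall>a. coprime a (int n) \<longrightarrow> [a = 1] (mod int d) \<longrightarrow> \<eta> a = 1"
  have key: "\<eta> a = \<eta> b" if ab: "coprime a (int n)" "coprime b (int n)" "[a = b] (mod int d)" for a b
  proof -
    \<comment> \<open>With \<open>b'\<close> inverse to \<open>b\<close> modulo \<open>n\<close>,
      the product \<open>a * b'\<close> lies in the kernel, so \<open>\<eta> a\<close> and
      \<open>\<eta> b\<close> are both inverse to \<open>\<eta> b'\<close>.\<close>
    obtain b' where b': "[b * b' = 1] (mod int n)" using cong_solve_coprime_int ab(2) by blast
    have cb': "coprime b' (int n)"
    proof -
      have "[b' * b = 1] (mod int n)" using b' by (simp only: mult.commute)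
      then show ?thesis unfolding coprime_iff_invertible_int by (rule exI)
    qed
    have "[b * b' = 1] (mod int d)" using b' d by (meson cong_dvd_modulus int_dvd_int_iff)
    then have "[a * b' = 1] (mod int d)" using ab(3) by (metis cong_scalar_right cong_trans)
    then have "\<eta> (a * b') = 1" using * ab cb' by simp
    moreover have "\<eta> (b * b') = 1"
      unfolding dirichlet_char_cong[OF \<eta> b'] by (rule dirichlet_char_one[OF \<eta>])
    moreover have "\<eta> b' \<noteq> 0" using cb' dirichlet_char_nonzero_iff[OF \<eta>] by simp
    ultimately show ?thesis unfolding dirichlet_char_mult[OF \<eta>] by (metis mult_right_cancel)
  qed
  \<comment> \<open>An arbitrary choice of lifts. It need not be multiplicative, but by
    \<open>key\<close> the value \<open>\<eta> (l a)\<close> depends only on \<open>a\<close> modulo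
    \<open>d\<close>.\<close>
  define l where "l = (\<lambda>a. SOME b. [b = a] (mod int d) \<and> coprime b (int n))"
  have l: "[l a = a] (mod int d)" "coprime (l a) (int n)" if "coprime a (int d)" for a
  proof -
    have "\<exists>b. [b = a] (mod int d) \<and> coprime b (int n)"
      using ex_coprime_lift[OF n d that] by metis
    from someI_ex[OF this] show "[l a = a] (mod int d)" "coprime (l a) (int n)"
      unfolding l_def by simp_all
  qed
  define \<psi> where "\<psi> = (\<lambda>a. if coprime a (int d) then \<eta> (l a) else 0)"
  have \<psi>: "\<psi> a = \<eta> b" if "coprime b (int n)" "[a = b] (mod int d)" for a b
  proof -
    have a: "coprime a (int d)" using that d coprime_int_dvd cong_coprime_int by blast
    then have "\<eta> (l a) = \<eta> b" using l[OF a] that by (intro key) (auto intro: cong_trans)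
    then show ?thesis using a by (simp add: \<psi>_def)
  qed
  have "dirichlet_char d \<psi>" unfolding dirichlet_char_def
  proof (intro conjI allI)
    fix a b
    show "\<psi> (a * b) = \<psi> a * \<psi> b"
    proof (cases "coprime a (int d) \<and> coprime b (int d)")
      case True
      then have "\<psi> (a * b) = \<eta> (l a * l b)" using l by (intro \<psi>) (auto intro!: cong_mult intro: cong_sym)
      then show ?thesis using True by (simp add: dirichlet_char_mult[OF \<eta>] \<psi>_def)
    qed (auto simp: \<psi>_def)
    show "\<psi> (a + int d) = \<psi> a"
    proof (cases "coprime a (int d)")
      case True
      then show ?thesis using \<psi>[of "l a" a] \<psi>[of "l a" "a + int d"] l[OF True]
        by (simp add: cong_def)
    next
      case False
      moreover have "\<not> coprime (a + int d) (int d)"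
        using False cong_coprime_int[of "a + int d" a "int d"] by (simp add: cong_def)
      ultimately show ?thesis by (simp add: \<psi>_def)
    qed
    show "\<psi> a \<noteq> 0 \<longleftrightarrow> coprime a (int d)"
      using l(2)[of a] dirichlet_char_nonzero_iff[OF \<eta>] by (simp add: \<psi>_def)
  qed
  moreover have "\<eta> a = \<psi> a" if "coprime a (int n)" for a using \<psi>[OF that] by simp
  ultimately show "induced_from n \<eta> d" by (auto simp: induced_from_def dirichlet_chars_def)
qed

lemma induced_from_mono:
  assumes "n > 0" "dirichlet_char n \<eta>" "d dvd e" "e dvd n" "induced_from n \<eta> d"
  shows "induced_from n \<eta> e"
proof -
  have "d dvd n" using assms dvd_trans by blast
  then show ?thesis using assms induced_from_iff[of n d \<eta>] induced_from_iff[of n e \<eta>]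
    by (metis cong_dvd_modulus int_dvd_int_iff)
qed

lemma induced_from_self: "dirichlet_char n \<eta> \<Longrightarrow> induced_from n \<eta> n"
  unfolding induced_from_def dirichlet_chars_def by (rule bexI[of _ \<eta>]) simp_all

text \<open>An \<open>a\<close> that is 1 modulo the gcd admits, by Bezout, a \<open>z\<close> that
  is 1 modulo \<open>d\<close> and \<open>a\<close> modulo \<open>e\<close>. The first congruence
  gives \<open>\<eta> z = 1\<close>, the second \<open>\<eta> z = \<eta> a\<close>.\<close>

lemma induced_from_gcd:
  assumes n: "n > 0" and \<eta>: "dirichlet_char n \<eta>" and d: "d dvd n" "e dvd n"
    and ind: "induced_from n \<eta> d" "induced_from n \<eta> e"
  shows "induced_from n \<eta> (gcd d e)"
proof -
  have g: "gcd d e dvd n" using d by (meson dvd_trans gcd_dvd1)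
  show ?thesis unfolding induced_from_iff[OF n g \<eta>]
  proof (intro allI impI)
    fix a assume a: "coprime a (int n)" "[a = 1] (mod int (gcd d e))"
    obtain u v where uv: "u * int d + v * int e = gcd (int d) (int e)" using bezout_int by blast
    obtain t where t: "a - 1 = int (gcd d e) * t" using a(2) by (auto simp: cong_iff_dvd_diff)
    define y where "y = 1 + int d * (u * t)"
    have y1: "[y = 1] (mod int d)" by (simp add: y_def cong_def)
    have "y - a = int d * (u * t) - int (gcd d e) * t" using t by (simp add: y_def)
    also have "int (gcd d e) = u * int d + v * int e" using uv by simp
    also have "int d * (u * t) - (u * int d + v * int e) * t = int e * (- v * t)"
      by (simp add: algebra_simps)
    finally have ya: "[y = a] (mod int e)" by (simp add: cong_iff_dvd_diff)
    \<comment> \<open>\<open>y\<close> solves both congruences but may share a factor with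
      \<open>n\<close>. Being coprime to the lcm of \<open>d\<close> and \<open>e\<close>, it can be
      replaced by a lift \<open>z\<close> that is a unit modulo \<open>n\<close>.\<close>
    have "coprime y (int d)" using y1 cong_coprime_int by (metis coprime_1_left)
    moreover have "coprime y (int e)" using ya cong_coprime_int a(1) d(2) coprime_int_dvd by blast
    ultimately have "coprime y (int (d * e))" by simp
    then have "coprime y (int (lcm d e))" by (rule coprime_int_dvd) (simp add: lcm_least)
    then obtain z where z: "[z = y] (mod int (lcm d e))" "coprime z (int n)"
      using ex_coprime_lift[OF n, of "lcm d e" y] d by (auto simp: lcm_least)
    have "[z = y] (mod int d)" "[z = y] (mod int e)"
      using z(1) by (meson cong_dvd_modulus int_dvd_int_iff dvd_lcm1 dvd_lcm2)+
    then have z': "[z = 1] (mod int d)" "[z = a] (mod int e)"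
      using y1 ya cong_trans by blast+
    have "\<eta> z = 1" using induced_from_iff[OF n d(1) \<eta>] ind(1) z(2) z'(1) by blast
    moreover have "\<eta> z = \<eta> a"
      using ind(2) z(2) z'(2) a(1) unfolding induced_from_def dirichlet_chars_def
      by (metis dirichlet_char_cong mem_Collect_eq)
    ultimately show "\<eta> a = 1" by simp
  qed
qed

text \<open>Extending a character modulo \<open>d\<close> by zero off the units modulo
  \<open>n\<close> is injective, since every unit modulo \<open>d\<close> has a lift that is a unit
  modulo \<open>n\<close>.\<close>

lemma card_induced_from:
  assumes n: "n > 0" and d: "d dvd n"
  shows "card {\<eta> \<in> dirichlet_chars n. induced_from n \<eta> d} = totient d"
proof -
  define F where "F = (\<lambda>\<psi> :: int \<Rightarrow> complex. \<lambda>a. if coprime a (int n) then \<psi> a else 0)"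
  have inj: "inj_on F (dirichlet_chars d)"
  proof (rule inj_onI, rule ext)
    fix \<psi> \<theta> a assume *: "\<psi> \<in> dirichlet_chars d" "\<theta> \<in> dirichlet_chars d" "F \<psi> = F \<theta>"
    have \<psi>: "dirichlet_char d \<psi>" and \<theta>: "dirichlet_char d \<theta>" using * by (auto simp: dirichlet_chars_def)
    show "\<psi> a = \<theta> a"
    proof (cases "coprime a (int d)")
      case True
      obtain b where b: "[b = a] (mod int d)" "coprime b (int n)" using ex_coprime_lift[OF n d True] .
      have "\<psi> b = \<theta> b" using fun_cong[OF *(3), of b] b by (simp add: F_def)
      then show ?thesis using dirichlet_char_cong[OF \<psi> b(1)] dirichlet_char_cong[OF \<theta> b(1)] by simp
    next
      case False
      then show ?thesis using dirichlet_char_nonzero_iff[OF \<psi>] dirichlet_char_nonzero_iff[OF \<theta>] by metis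
    qed
  qed
  have "F ` dirichlet_chars d = {\<eta> \<in> dirichlet_chars n. induced_from n \<eta> d}"
  proof (intro equalityI subsetI)
    fix \<eta> assume "\<eta> \<in> F ` dirichlet_chars d"
    then obtain \<psi> where \<psi>: "dirichlet_char d \<psi>" "\<eta> = F \<psi>" by (auto simp: dirichlet_chars_def)
    have "dirichlet_char n \<eta>" unfolding dirichlet_char_def
    proof (intro conjI allI)
      fix a b
      have c: "coprime (a + int n) (int n) \<longleftrightarrow> coprime a (int n)"
        by (intro cong_coprime_int) (simp add: cong_def)
      have "[a + int n = a] (mod int d)" using d by (simp add: cong_iff_dvd_diff)
      then show "\<eta> (a + int n) = \<eta> a" using dirichlet_char_cong[OF \<psi>(1)] c by (simp add: \<psi>(2) F_def)
      show "\<eta> (a * b) = \<eta> a * \<eta> b" by (simp add: \<psi>(2) F_def dirichlet_char_mult[OF \<psi>(1)])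
      show "\<eta> a \<noteq> 0 \<longleftrightarrow> coprime a (int n)"
        using dirichlet_char_nonzero_iff[OF \<psi>(1), of a] coprime_int_dvd[OF _ d, of a] by (simp add: \<psi>(2) F_def)
    qed
    moreover have "induced_from n \<eta> d"
      using \<psi> by (auto simp: induced_from_def dirichlet_chars_def F_def)
    ultimately show "\<eta> \<in> {\<eta> \<in> dirichlet_chars n. induced_from n \<eta> d}" by (simp add: dirichlet_chars_def)
  next
    fix \<eta> assume "\<eta> \<in> {\<eta> \<in> dirichlet_chars n. induced_from n \<eta> d}"
    then have \<eta>: "dirichlet_char n \<eta>" "induced_from n \<eta> d" by (auto simp: dirichlet_chars_def)
    then obtain \<psi> where \<psi>: "\<psi> \<in> dirichlet_chars d" "\<And>a. coprime a (int n) \<Longrightarrow> \<eta> a = \<psi> a"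
      by (auto simp: induced_from_def)
    have "F \<psi> = \<eta>"
    proof
      fix a show "F \<psi> a = \<eta> a" using \<psi>(2)[of a] dirichlet_char_nonzero_iff[OF \<eta>(1), of a] by (auto simp: F_def)
    qed
    then show "\<eta> \<in> F ` dirichlet_chars d" using \<psi>(1) by blast
  qed
  then have "card {\<eta> \<in> dirichlet_chars n. induced_from n \<eta> d} = card (dirichlet_chars d)"
    using card_image[OF inj] by simp
  also have "d > 0" using n d by (auto intro: Nat.gr0I)
  then have "card (dirichlet_chars d) = totient d" by (rule card_dirichlet_chars)
  finally show ?thesis .
qed

text \<open>Being induced passes upwards along divisibility, so only the maximal proper divisors
  \<open>n div p\<close> need testing: a proper divisor \<open>d\<close> divides
  \<open>n div p\<close> for any prime \<open>p\<close> dividing \<open>n div d\<close>.\<close>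

lemma conductor_eq_self_iff:
  assumes n: "n > 0" and \<eta>: "dirichlet_char n \<eta>"
  shows "conductor n \<eta> = n \<longleftrightarrow> (\<forall>p\<in>prime_factors n. \<not> induced_from n \<eta> (n div p))"
proof -
  let ?P = "\<lambda>d. d dvd n \<and> induced_from n \<eta> d"
  have Pn: "?P n" using induced_from_self[OF \<eta>] by simp
  show ?thesis
  proof
    assume c: "conductor n \<eta> = n"
    show "\<forall>p\<in>prime_factors n. \<not> induced_from n \<eta> (n div p)"
    proof (intro ballI notI)
      fix p assume p: "p \<in> prime_factors n" "induced_from n \<eta> (n div p)"
      then have pp: "prime p" "p dvd n" by auto
      then have "n div p < n" using n prime_gt_1_nat by simp
      moreover have "?P (n div p)" using p pp div_dvd_self_nat by blast
      ultimately show False using c not_less_Least[of "n div p" ?P] by (simp add: conductor_def)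
    qed
  next
    assume *: "\<forall>p\<in>prime_factors n. \<not> induced_from n \<eta> (n div p)"
    define d where "d = conductor n \<eta>"
    have d: "d dvd n" "induced_from n \<eta> d"
      unfolding d_def conductor_def using LeastI[of ?P, OF Pn] by auto
    then obtain k where k: "n = d * k" by auto
    show "conductor n \<eta> = n"
    proof (rule ccontr)
      assume "conductor n \<eta> \<noteq> n"
      then have "k \<noteq> 1" using k unfolding d_def [symmetric] by auto
      then obtain p where p: "prime p" "p dvd k" using prime_factor_nat by blast
      then have pn: "p \<in> prime_factors n" using k n by (auto simp: prime_factors_dvd)
      obtain j where j: "k = p * j" using p by auto
      have "n div p = d * j" using k j p by simp
      then have "d dvd n div p" by simp
      then have "induced_from n \<eta> (n div p)"
        using induced_from_mono[OF n \<eta> _ _ d(2), of "n div p"] pn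
          \<open>d dvd n div p\<close> div_dvd_self_nat[OF in_prime_factors_imp_dvd[OF pn]] by simp
      then show False using * pn by blast
    qed
  qed
qed

lemma totient_prime_mult:
  assumes "prime p"
  shows "totient (p * e) = (if p dvd e then p else p - 1) * totient e"
proof (cases "p dvd e")
  case True
  then have "gcd p e = p" by (simp add: gcd_proj1_if_dvd_nat)
  then show ?thesis using True assms prime_gt_1_nat[OF assms]
    by (simp add: totient_mult totient_prime)
next
  case False
  then have "coprime p e" using assms prime_imp_coprime by blast
  then show ?thesis using False assms by (simp add: totient_mult_coprime totient_prime)
qed

lemma prod_prime_factors_subset_dvd:
  fixes n :: nat
  assumes "n > 0" "Q \<subseteq> prime_factors n"
  shows "\<Prod>Q dvd n"
proof -
  have "\<Prod>Q dvd \<Prod>(prime_factors n)" using assms by (intro prod_dvd_prod_subset) auto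
  also have "\<dots> dvd (\<Prod>p\<in>prime_factors n. p ^ multiplicity p n)"
    by (intro prod_dvd_prod dvd_power) (auto simp: prime_factors_multiplicity)
  also have "\<dots> = n" using assms by (metis prime_factorization_nat)
  finally show ?thesis .
qed

text \<open>Inclusion-exclusion, one prime at a time. Forbidding a further \<open>q\<close>
  subtracts the count with \<open>q\<close> moved into \<open>Q\<close>, because being induced from
  both \<open>n div \<Prod>Q\<close> and \<open>n div q\<close> means being induced from their gcd.
  \<open>Q\<close> is carried along to make this induction possible.\<close>

lemma card_induced_not_induced:
  fixes P Q :: "nat set"
  assumes n: "n > 0" and "finite P" "P \<subseteq> prime_factors n" "Q \<subseteq> prime_factors n" "P \<inter> Q = {}"
  shows "real (card {\<eta> \<in> dirichlet_chars n. induced_from n \<eta> (n div \<Prod>Q) \<and>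
                        (\<forall>p\<in>P. \<not> induced_from n \<eta> (n div p))}) =
         real (totient (n div \<Prod>Q)) * (\<Prod>p\<in>P. 1 - 1 / (if p\<^sup>2 dvd n then real p else real p - 1))"
  using assms(2-)
proof (induction P arbitrary: Q rule: finite_induct)
  case empty
  have "\<Prod>Q dvd n" by (rule prod_prime_factors_subset_dvd[OF n empty.prems(2)])
  then have "n div \<Prod>Q dvd n" by (rule div_dvd_self_nat)
  then show ?case using card_induced_from[OF n] by simp
next
  case (insert q P)
  have q: "prime q" "q dvd n" "q \<notin> Q" using insert by (auto simp: prime_factors_dvd)
  have finQ: "finite Q" using insert.prems finite_subset by blast
  have dvd: "\<Prod>(insert q Q) dvd n"
    using insert.prems by (intro prod_prime_factors_subset_dvd[OF n]) auto
  have prodi: "\<Prod>(insert q Q) = q * \<Prod>Q" using q finQ by simp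
  obtain e where e: "n = q * \<Prod>Q * e" using dvd unfolding prodi by auto
  have pos: "\<Prod>Q > 0" "q > 0" using n e by (auto intro: Nat.gr0I)
  have d1: "n div \<Prod>Q = q * e" using e pos by simp
  have d2: "n div \<Prod>(insert q Q) = e" unfolding prodi using e pos by simp
  have d3: "n div q = \<Prod>Q * e" using e pos by simp
  have cop: "coprime q (\<Prod>Q)"
  proof (rule prod_coprime_right)
    fix x assume "x \<in> Q"
    then have "prime x" "x \<noteq> q" using insert.prems q by (auto simp: prime_factors_dvd)
    then show "coprime q x" using q(1) primes_coprime by blast
  qed
  have gcd: "gcd (n div \<Prod>Q) (n div q) = n div \<Prod>(insert q Q)"
    unfolding d1 d2 d3 using cop by (simp add: gcd_mult_distrib_nat [symmetric] gcd_mult_right mult.commute[of _ e])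
  \<comment> \<open>Since \<open>q\<close> is not in \<open>Q\<close>, dividing by
    \<open>\<Prod>Q\<close> leaves the power of \<open>q\<close> in \<open>n\<close> unchanged; this
    translates the case distinction of \<open>totient_prime_mult\<close> into a condition on
    \<open>n\<close>.\<close>
  have sq: "q\<^sup>2 dvd n \<longleftrightarrow> q dvd e"
  proof -
    have "q\<^sup>2 dvd n \<longleftrightarrow> q dvd \<Prod>Q * e" unfolding e power2_eq_square mult.assoc using pos by simp
    also have "\<dots> \<longleftrightarrow> q dvd e" using cop by (simp add: coprime_dvd_mult_right_iff)
    finally show ?thesis .
  qed
  define A where "A = (\<lambda>R. {\<eta> \<in> dirichlet_chars n. induced_from n \<eta> (n div \<Prod>R) \<and>
                        (\<forall>p\<in>P. \<not> induced_from n \<eta> (n div p))})"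
  have fin: "finite (A R)" for R using finite_dirichlet_chars[OF n] by (simp add: A_def)
  have ind: "induced_from n \<eta> (n div \<Prod>(insert q Q)) \<longleftrightarrow> induced_from n \<eta> (n div \<Prod>Q) \<and> induced_from n \<eta> (n div q)"
    if \<eta>: "dirichlet_char n \<eta>" for \<eta>
  proof
    assume *: "induced_from n \<eta> (n div \<Prod>(insert q Q))"
    show "induced_from n \<eta> (n div \<Prod>Q) \<and> induced_from n \<eta> (n div q)"
    proof
      show "induced_from n \<eta> (n div \<Prod>Q)"
        by (rule induced_from_mono[OF n \<eta> _ _ *]; unfold d1 d2) (simp_all add: e)
      show "induced_from n \<eta> (n div q)"
        by (rule induced_from_mono[OF n \<eta> _ _ *]; unfold d3 d2) (simp_all add: e)
    qed
  next
    assume *: "induced_from n \<eta> (n div \<Prod>Q) \<and> induced_from n \<eta> (n div q)"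
    have "q * e dvd n" "\<Prod>Q * e dvd n" by (auto simp: e)
    then show "induced_from n \<eta> (n div \<Prod>(insert q Q))"
      unfolding gcd [symmetric] using * by (intro induced_from_gcd[OF n \<eta>]) (simp_all only: d1 d3)
  qed
  have "{\<eta> \<in> dirichlet_chars n. induced_from n \<eta> (n div \<Prod>Q) \<and>
                        (\<forall>p\<in>insert q P. \<not> induced_from n \<eta> (n div p))} = A Q - A (insert q Q)"
    using ind unfolding A_def dirichlet_chars_def by blast
  moreover have "A (insert q Q) \<subseteq> A Q" using ind unfolding A_def dirichlet_chars_def by blast
  ultimately have "real (card {\<eta> \<in> dirichlet_chars n. induced_from n \<eta> (n div \<Prod>Q) \<and>
                        (\<forall>p\<in>insert q P. \<not> induced_from n \<eta> (n div p))}) =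
       real (card (A Q)) - real (card (A (insert q Q)))"
    using fin by (simp add: card_Diff_subset of_nat_diff card_mono)
  also have "real (card (A Q)) = real (totient (n div \<Prod>Q)) * (\<Prod>p\<in>P. 1 - 1 / (if p\<^sup>2 dvd n then real p else real p - 1))"
    unfolding A_def using insert by (intro insert.IH) auto
  also have "real (card (A (insert q Q))) = real (totient (n div \<Prod>(insert q Q))) * (\<Prod>p\<in>P. 1 - 1 / (if p\<^sup>2 dvd n then real p else real p - 1))"
    unfolding A_def using insert by (intro insert.IH) auto
  also have "real (totient (n div \<Prod>(insert q Q))) =
      real (totient (n div \<Prod>Q)) / (if q\<^sup>2 dvd n then real q else real q - 1)"
    unfolding d1 d2 sq totient_prime_mult[OF q(1)] using prime_gt_1_nat[OF q(1)] by (simp add: of_nat_diff)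
  finally show ?case using insert.hyps by (simp add: algebra_simps)
qed

theorem primitive_proportion_eq:
  assumes n: "n > 0"
  shows "primitive_proportion n =
           (\<Prod>p\<in>prime_factors n. 1 - 1 / (if p\<^sup>2 dvd n then real p else real p - 1))"
proof -
  \<comment> \<open>The empty product is 1, and every character modulo \<open>n\<close> is induced
    from \<open>n\<close> itself.\<close>
  have "primitive_dirichlet_chars n = {\<eta> \<in> dirichlet_chars n. induced_from n \<eta> (n div \<Prod>{}) \<and>
                        (\<forall>p\<in>prime_factors n. \<not> induced_from n \<eta> (n div p))}"
    using conductor_eq_self_iff[OF n] induced_from_self
    by (auto simp: primitive_dirichlet_chars_def dirichlet_chars_def)
  then show ?thesis unfolding primitive_proportion_def
    using card_induced_not_induced[OF n, of "prime_factors n" "{}"] n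
    by (simp add: card_dirichlet_chars)
qed

section \<open>The sum of ln p / p over primes\<close>

text \<open>Passing from \<open>N\<close> to \<open>Suc N\<close> raises \<open>N div d\<close> by
  one exactly at the divisors \<open>d\<close> of \<open>Suc N\<close>, over which
  \<open>mangoldt\<close> sums to \<open>ln (Suc N)\<close>.\<close>

lemma sum_mangoldt_mult_div:
  "(\<Sum>d=1..N. mangoldt d * real (N div d)) = ln (fact N :: real)"
proof (induction N)
  case (Suc N)
  have div: "real (Suc N div d) = real (N div d) + (if d dvd Suc N then 1 else 0)" for d
    by (simp add: div_Suc dvd_eq_mod_eq_0)
  have "(\<Sum>d=1..Suc N. mangoldt d * real (Suc N div d)) =
        (\<Sum>d=1..Suc N. mangoldt d * real (N div d)) +
        (\<Sum>d=1..Suc N. if d dvd Suc N then mangoldt d else 0)"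
    unfolding sum.distrib [symmetric] by (intro sum.cong refl) (simp add: div distrib_left)
  also have "(\<Sum>d=1..Suc N. mangoldt d * real (N div d)) = ln (fact N :: real)"
    using Suc.IH by simp
  also have "(\<Sum>d=1..Suc N. if d dvd Suc N then mangoldt d else (0::real)) =
             (\<Sum>d | d dvd Suc N. mangoldt d)"
    by (subst sum.inter_filter [symmetric])
       (auto intro!: sum.cong Nat.gr0I simp: Suc_le_eq dest: dvd_imp_le)
  also have "\<dots> = ln (real (Suc N))" by (subst mangoldt_sum) auto
  finally show ?case by (simp add: ln_mult)
qed simp

lemma ln_fact_le: "N > 0 \<Longrightarrow> ln (fact N :: real) \<le> real N * ln (real N)"
proof -
  assume N: "N > 0"
  have "(fact N :: real) \<le> real (N ^ N)" by (rule fact_le_power)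
  then have "ln (fact N :: real) \<le> ln (real (N ^ N))" using N by (subst ln_le_cancel_iff) auto
  then show ?thesis using N by (simp add: ln_realpow)
qed

lemma ln_fact_ge: "real N * ln (real N) - real N \<le> ln (fact N :: real)"
proof (induction N)
  case (Suc N)
  have "real N * (ln (real (Suc N)) - ln (real N)) \<le> 1"
  proof (cases "N = 0")
    case False
    have "ln (real (Suc N)) - ln (real N) = ln (1 + 1 / real N)"
    proof -
      have "1 + 1 / real N = real (Suc N) / real N" using False by (simp add: field_simps)
      then show ?thesis using False by (simp add: ln_div)
    qed
    also have "\<dots> \<le> 1 / real N" by (rule ln_add_one_self_le_self) simp
    finally show ?thesis using False by (simp add: field_simps)
  qed simp
  moreover have "ln (fact (Suc N) :: real) = ln (real (Suc N)) + ln (fact N)"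
    unfolding fact_Suc of_nat_mult of_nat_fact by (subst ln_mult) auto
  ultimately show ?case using Suc by (simp add: algebra_simps)
qed simp

text \<open>The difference \<open>(2 * M) div d - 2 * (M div d)\<close> is never negative and is at
  least 1 for \<open>M < d \<le> 2 * M\<close>. The sum is therefore at most the logarithm of the
  central binomial coefficient, which is at most \<open>2 ^ (2 * M)\<close>.\<close>

lemma sum_mangoldt_doubling: "(\<Sum>d=Suc M..2*M. mangoldt d) \<le> 2 * real M * ln 2"
proof -
  have le: "(if d \<in> {Suc M..2*M} then mangoldt d else 0) \<le>
              mangoldt d * real ((2 * M) div d) - 2 * (mangoldt d * real (M div d))"
    if "d \<in> {1..2*M}" for d
  proof -
    have "2 * (M div d) * d \<le> 2 * M" by (simp add: mult.assoc)
    then have "2 * (M div d) \<le> (2 * M) div d"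
      using that by (simp add: less_eq_div_iff_mult_less_eq)
    moreover have "2 * (M div d) + 1 \<le> (2 * M) div d" if "d \<in> {Suc M..2*M}"
    proof -
      have "M div d = 0" "(2 * M) div d \<ge> 1" using that by (auto simp: Suc_le_eq div_greater_zero_iff)
      then show ?thesis by simp
    qed
    ultimately have "(if d \<in> {Suc M..2*M} then 1 else 0) \<le> real ((2 * M) div d) - 2 * real (M div d)"
      by (auto split: if_splits)
    then have "mangoldt d * (if d \<in> {Suc M..2*M} then 1 else 0) \<le>
        mangoldt d * (real ((2 * M) div d) - 2 * real (M div d))"
      by (intro mult_left_mono mangoldt_nonneg)
    then show ?thesis by (auto simp: algebra_simps split: if_splits)
  qed
  have "(\<Sum>d=Suc M..2*M. mangoldt d) = (\<Sum>d=1..2*M. if d \<in> {Suc M..2*M} then mangoldt d else (0::real))"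
    by (subst sum.inter_restrict [symmetric]) (auto intro!: sum.cong)
  also have "\<dots> \<le> (\<Sum>d=1..2*M. mangoldt d * real ((2 * M) div d) - 2 * (mangoldt d * real (M div d)))"
    by (intro sum_mono le)
  also have "\<dots> = ln (fact (2 * M)) - 2 * (\<Sum>d=1..2*M. mangoldt d * real (M div d))"
    by (simp only: sum_subtractf sum_distrib_left [symmetric] sum_mangoldt_mult_div)
  also have "(\<Sum>d=1..2*M. mangoldt d * real (M div d)) = (\<Sum>d=1..M. mangoldt d * real (M div d))"
    by (intro sum.mono_neutral_right) auto
  also have "\<dots> = ln (fact M)" by (rule sum_mangoldt_mult_div)
  also have "ln (fact (2 * M)) - 2 * ln (fact M) \<le> 2 * real M * ln 2"
  proof -
    have "fact M * fact (2 * M - M) * ((2 * M) choose M) = (fact (2 * M) :: nat)"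
      by (rule binomial_fact_lemma) simp
    moreover have "(2 * M) choose M \<le> 2 ^ (2 * M)"
    proof -
      have "(2 * M) choose M \<le> (\<Sum>k\<le>2*M. (2*M) choose k)"
        by (rule member_le_sum) auto
      then show ?thesis by (simp add: choose_row_sum)
    qed
    ultimately have "(fact (2 * M) :: nat) \<le> fact M * fact M * 2 ^ (2 * M)"
      by (metis add_diff_cancel_left' mult_2 mult_le_mono2)
    then have "real (fact (2 * M)) \<le> real (fact M * fact M * 2 ^ (2 * M))" by (simp only: of_nat_le_iff)
    then have "(fact (2 * M) :: real) \<le> fact M * fact M * 2 ^ (2 * M)" by simp
    then have "ln (fact (2 * M) :: real) \<le> ln (fact M * fact M * 2 ^ (2 * M))"
      by (subst ln_le_cancel_iff) auto
    also have "\<dots> = 2 * ln (fact M) + 2 * real M * ln 2"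
      by (simp add: ln_mult ln_realpow)
    finally show ?thesis by simp
  qed
  finally show ?thesis .
qed

text \<open>Chebyshev's upper bound, by halving \<open>N\<close> and applying the doubling estimate.
  An odd \<open>N\<close> leaves one extra term, at most \<open>ln N\<close>.\<close>

lemma sum_mangoldt_le: "(\<Sum>d=1..N. mangoldt d) \<le> 4 * real N"
proof (induction N rule: less_induct)
  case (less N)
  show ?case
  proof (cases "N = 0")
    case False
    define M where "M = N div 2"
    have M: "M < N" "2 * M \<le> N" "N \<le> 2 * M + 1" using False by (auto simp: M_def)
    have l2: "ln 2 \<le> (1::real)" using ln_le_minus_one[of "2::real"] by simp
    have "{1..N} = {1..M} \<union> {Suc M..2*M} \<union> {Suc (2*M)..N}" using M by auto
    also have "sum mangoldt \<dots> = sum mangoldt ({1..M} \<union> {Suc M..2*M}) + (\<Sum>d=Suc (2*M)..N. mangoldt d :: real)"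
      by (intro sum.union_disjoint) auto
    also have "sum mangoldt ({1..M} \<union> {Suc M..2*M}) = (\<Sum>d=1..M. mangoldt d) + (\<Sum>d=Suc M..2*M. mangoldt d :: real)"
      by (intro sum.union_disjoint) auto
    finally have "(\<Sum>d=1..N. mangoldt d) = (\<Sum>d=1..M. mangoldt d) +
        ((\<Sum>d=Suc M..2*M. mangoldt d) + (\<Sum>d=Suc (2*M)..N. mangoldt d :: real))"
      by simp
    also have "\<dots> \<le> 4 * real M + (2 * real M * ln 2 + real N)"
    proof (intro add_mono less.IH M sum_mangoldt_doubling)
      show "(\<Sum>d=Suc (2*M)..N. mangoldt d) \<le> real N"
      proof (cases "N = 2 * M")
        case False
        then have "N = Suc (2 * M)" using M by simp
        then have "(\<Sum>d=Suc (2*M)..N. mangoldt d) = (mangoldt N :: real)" by simp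
        also have "\<dots> \<le> ln (real N)" using \<open>N \<noteq> 0\<close> by (intro mangoldt_le) simp
        also have "\<dots> \<le> real N" using \<open>N \<noteq> 0\<close> ln_le_minus_one[of "real N"] by simp
        finally show ?thesis .
      qed simp
    qed
    also have "2 * real M * ln 2 \<le> 2 * real M * 1" using l2 by (intro mult_left_mono) auto
    \<comment> \<open>Here \<open>6 * M \<le> 3 * N\<close>, which is why the constant 4 reproduces
      itself.\<close>
    also have "4 * real M + (2 * real M * 1 + real N) \<le> 4 * real N" using M by linarith
    finally show ?thesis by simp
  qed simp
qed

text \<open>Replacing \<open>N div d\<close> by \<open>N / d\<close> in the formula for
  \<open>ln (fact N)\<close> costs at most the sum of \<open>mangoldt\<close>, which is at most
  \<open>4 * N\<close>; then both sides are divided by \<open>N\<close>.\<close>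

lemma sum_mangoldt_over_bounds:
  assumes N: "N > 0"
  shows "\<bar>(\<Sum>d=1..N. mangoldt d / real d) - ln (real N)\<bar> \<le> 4"
proof -
  have le: "mangoldt d * real (N div d) \<le> mangoldt d * (real N / real d)"
    and ge: "mangoldt d * (real N / real d) \<le> mangoldt d * real (N div d) + mangoldt d" for d
  proof -
    have "real (N div d) \<le> real N / real d" by (rule of_nat_div_le_of_nat)
    then show "mangoldt d * real (N div d) \<le> mangoldt d * (real N / real d)"
      by (intro mult_left_mono mangoldt_nonneg)
    have "real N / real d \<le> real (N div d) + 1"
      using floor_divide_of_nat_eq[of N d, where ?'a = real] by linarith
    then have "mangoldt d * (real N / real d) \<le> mangoldt d * (real (N div d) + 1)"
      by (intro mult_left_mono mangoldt_nonneg)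
    then show "mangoldt d * (real N / real d) \<le> mangoldt d * real (N div d) + mangoldt d"
      by (simp add: algebra_simps)
  qed
  define S where "S = (\<Sum>d=1..N. mangoldt d / real d)"
  have S: "real N * S = (\<Sum>d=1..N. mangoldt d * (real N / real d))"
    by (simp add: S_def sum_distrib_left field_simps)
  have "ln (fact N) \<le> real N * S"
    unfolding S sum_mangoldt_mult_div [symmetric] by (intro sum_mono le)
  then have "real N * ln (real N) - real N \<le> real N * S" using ln_fact_ge[of N] by linarith
  then have "real N * (ln (real N) - 1) \<le> real N * S" by (simp add: algebra_simps)
  moreover have "real N * S \<le> ln (fact N) + (\<Sum>d=1..N. mangoldt d)"
    unfolding S sum_mangoldt_mult_div [symmetric] sum.distrib [symmetric] by (intro sum_mono ge)
  then have "real N * S \<le> real N * ln (real N) + 4 * real N"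
    using ln_fact_le[OF N] sum_mangoldt_le[of N] by linarith
  then have "real N * S \<le> real N * (ln (real N) + 4)" by (simp add: algebra_simps)
  ultimately show ?thesis using N by (simp add: S_def abs_le_iff)
qed

lemma sum_mangoldt_nonprime_bounded:
  obtains K where "\<And>N. (\<Sum>d=1..N. if prime d then 0 else mangoldt d / real d) \<le> K"
proof -
  \<comment> \<open>One factor 2 comes from \<open>ln p \<le> 2 * p powr (1/2)\<close>, the other
    from the geometric series with ratio \<open>1 / p\<close>, at most \<open>1/2\<close>. The sum
    over the powers of \<open>p\<close> starts at its square, which leaves the exponent
    \<open>1/2 - 2\<close>.\<close>
  define g where "g = (\<lambda>n::nat. 4 * real n powr (-3/2))"
  have "summable g" unfolding g_def by (intro summable_mult) (simp add: summable_real_powr_iff)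
  have g0: "g n \<ge> 0" for n by (simp add: g_def)
  have "(\<Sum>d=1..N. if prime d then 0 else mangoldt d / real d) \<le> suminf g" for N
  proof -
    define I where "I = {p\<in>{..N}. prime p} \<times> {..N}"
    define f where "f = (\<lambda>(p, k). p ^ (k + 2) :: nat)"
    define h where "h = (\<lambda>d::nat. mangoldt d / real d :: real)"
    have finI: "finite I" by (simp add: I_def)
    have h0: "h d \<ge> 0" for d by (simp add: h_def mangoldt_nonneg)
    have "(\<Sum>d=1..N. if prime d then 0 else mangoldt d / real d) =
        (\<Sum>d | d \<in> {1..N} \<and> primepow d \<and> \<not> prime d. h d)"
      by (rule sum.mono_neutral_cong_right) (auto simp: h_def mangoldt_def)
    also have "\<dots> \<le> sum h (f ` I)"
    proof (rule sum_mono2)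
      show "{d \<in> {1..N}. primepow d \<and> \<not> prime d} \<subseteq> f ` I"
      proof
        fix d assume d: "d \<in> {d \<in> {1..N}. primepow d \<and> \<not> prime d}"
        then obtain p k where pk: "prime p" "k > 0" "d = p ^ k" by (auto simp: primepow_def)
        with d have "k \<noteq> 1" by auto
        with pk have k: "k = (k - 2) + 2" by simp
        have "k < p ^ k" using prime_gt_1_nat[OF pk(1)] by (simp add: power_gt_expt)
        then have "k \<le> N" using d pk by simp
        moreover have "p \<le> p ^ k" using prime_gt_1_nat[OF pk(1)] pk(2) by (simp add: self_le_power)
        then have "p \<le> N" using d pk by simp
        ultimately have "(p, k - 2) \<in> I" using pk by (simp add: I_def)
        moreover have "f (p, k - 2) = d" unfolding f_def prod.case using k pk(3) by metis
        ultimately show "d \<in> f ` I" by blast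
      qed
    qed (use finI h0 in auto)
    also have "\<dots> \<le> sum (h \<circ> f) I" by (rule sum_image_le) (use finI h0 in auto)
    also have "\<dots> = (\<Sum>p | p \<in> {..N} \<and> prime p. \<Sum>k\<le>N. h (p ^ (k + 2)))"
      unfolding I_def by (subst sum.cartesian_product) (auto simp: f_def case_prod_unfold)
    also have "\<dots> \<le> (\<Sum>p | p \<in> {..N} \<and> prime p. g p)"
    proof (rule sum_mono)
      fix p assume "p \<in> {p. p \<in> {..N} \<and> prime p}"
      then have p: "prime p" by simp
      then have p2: "real p \<ge> 2" using prime_ge_2_nat of_nat_le_iff[of 2 p] by simp
      define x where "x = 1 / real p"
      have x: "0 < x" "x \<le> 1/2" using p2 by (auto simp: x_def)
      have "(\<Sum>k\<le>N. h (p ^ (k + 2))) = (\<Sum>k\<le>N. ln (real p) * x\<^sup>2 * x ^ k)"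
        by (intro sum.cong) (simp_all only: h_def mangoldt_primepow'[OF p] x_def, simp_all add: power_add power2_eq_square field_simps)
      also have "\<dots> = ln (real p) * x\<^sup>2 * (\<Sum>k\<le>N. x ^ k)" by (simp add: sum_distrib_left)
      also have "(\<Sum>k\<le>N. x ^ k) \<le> 2"
      proof -
        have "(\<Sum>k\<le>N. x ^ k) = (1 - x ^ Suc N) / (1 - x)"
          using x sum_gp0[of x N] by simp
        also have "\<dots> \<le> 1 / (1 - x)" using x by (intro divide_right_mono) auto
        also have "\<dots> \<le> 2" using x by (simp add: field_simps)
        finally show ?thesis .
      qed
      then have "ln (real p) * x\<^sup>2 * (\<Sum>k\<le>N. x ^ k) \<le> ln (real p) * x\<^sup>2 * 2"
        using p2 by (intro mult_left_mono) auto
      also have "\<dots> \<le> (2 * real p powr (1/2)) * x\<^sup>2 * 2"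
      proof -
        have "ln (real p) = 2 * ln (real p powr (1/2))" using p2 by (simp add: ln_powr)
        also have "\<dots> \<le> 2 * real p powr (1/2)" using p2 ln_le_minus_one[of "real p powr (1/2)"] by simp
        finally show ?thesis by (intro mult_right_mono) auto
      qed
      also have "\<dots> = g p"
      proof -
        have "x\<^sup>2 = real p powr (-2)" using p2 by (simp add: x_def powr_minus powr_numeral field_simps)
        then show ?thesis by (simp add: g_def powr_add [symmetric])
      qed
      finally show "(\<Sum>k\<le>N. h (p ^ (k + 2))) \<le> g p" .
    qed
    also have "\<dots> \<le> suminf g"
      using g0 \<open>summable g\<close> by (intro sum_le_suminf) auto
    finally show ?thesis .
  qed
  then show ?thesis using that by blast
qed

text \<open>Mertens' first theorem: the higher prime powers contribute a nonnegative bounded amount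
  to the sum over \<open>mangoldt\<close>.\<close>

theorem sum_ln_prime_over_prime_bounded:
  obtains K where "\<And>N. N > 0 \<Longrightarrow>
    \<bar>(\<Sum>p\<le>N. if prime p then ln (real p) / real p else 0) - ln (real N)\<bar> \<le> K"
proof -
  obtain K where K: "\<And>N. (\<Sum>d=1..N. if prime d then 0 else mangoldt d / real d) \<le> K"
    using sum_mangoldt_nonprime_bounded by blast
  have "\<bar>(\<Sum>p\<le>N. if prime p then ln (real p) / real p else 0) - ln (real N)\<bar> \<le> 4 + K" if N: "N > 0" for N
  proof -
    define P where "P = (\<Sum>p\<le>N. if prime p then ln (real p) / real p else 0)"
    define Q where "Q = (\<Sum>d=1..N. if prime d then 0 else mangoldt d / real d)"
    have "P = (\<Sum>p=1..N. if prime p then mangoldt p / real p else 0)"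
      unfolding P_def
      by (rule sum.mono_neutral_cong_right) (auto simp: Suc_le_eq dest: prime_gt_0_nat)
    then have "P + Q = (\<Sum>d=1..N. mangoldt d / real d)"
      by (simp add: Q_def sum.distrib [symmetric]) (intro sum.cong; simp)
    moreover have "Q \<ge> 0" unfolding Q_def by (intro sum_nonneg) (simp add: mangoldt_nonneg)
    moreover have "Q \<le> K" unfolding Q_def by (rule K)
    ultimately show ?thesis unfolding P_def [symmetric] using sum_mangoldt_over_bounds[OF N] by linarith
  qed
  then show ?thesis using that by blast
qed

section \<open>Mertens' third theorem\<close>

text \<open>Summation by parts: the boundary term vanishes in the limit, and the remaining series is
  dominated by \<open>K\<close> times a telescoping one.\<close>

lemma convergent_sum_diff_mult:
  fixes R b :: "nat \<Rightarrow> real"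
  assumes R: "\<And>n. \<bar>R n\<bar> \<le> K" and b: "decseq b" "b \<longlonglongrightarrow> 0"
  shows "convergent (\<lambda>N. \<Sum>n<N. (R (Suc n) - R n) * b (Suc n))"
proof -
  have b0: "b n \<ge> 0" for n using decseq_ge[OF b] .
  have bS: "b (Suc n) \<le> b n" for n using b(1) by (simp add: decseq_Suc_iff)
  have eq: "(\<Sum>n<N. (R (Suc n) - R n) * b (Suc n)) =
      R N * b N - R 0 * b 0 + (\<Sum>n<N. R n * (b n - b (Suc n)))" for N
    by (induction N) (simp_all add: algebra_simps)
  have "(\<lambda>N. R N * b N) \<longlonglongrightarrow> 0"
  proof (rule Lim_null_comparison)
    show "eventually (\<lambda>N. norm (R N * b N) \<le> K * b N) sequentially"
      using R b0 by (simp add: abs_mult mult_right_mono)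
    show "(\<lambda>N. K * b N) \<longlonglongrightarrow> 0" using tendsto_mult[OF tendsto_const b(2), of K] by simp
  qed
  then have "convergent (\<lambda>N. R N * b N - R 0 * b 0)"
    by (intro convergent_diff convergent_const) (rule convergentI)
  moreover have "summable (\<lambda>n. R n * (b n - b (Suc n)))"
  proof (rule summable_comparison_test')
    show "summable (\<lambda>n. K * (b n - b (Suc n)))"
      using telescope_summable'[OF b(2)] by (rule summable_mult)
    show "norm (R n * (b n - b (Suc n))) \<le> K * (b n - b (Suc n))" if "n \<ge> 0" for n
      using R[of n] bS[of n] by (simp add: abs_mult mult_right_mono)
  qed
  then have "convergent (\<lambda>N. \<Sum>n<N. R n * (b n - b (Suc n)))" by (simp add: summable_iff_convergent)
  ultimately show ?thesis unfolding eq by (rule convergent_add)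
qed

definition prime_recip :: "nat \<Rightarrow> real" where
  "prime_recip n = (if prime n then 1 / real n else 0)"

text \<open>Partial summation recovers \<open>1 / p\<close> from \<open>ln p / p\<close> with the
  weight \<open>1 / ln p\<close>. This yields only the existence of the limit; its value is found
  later.\<close>

lemma convergent_sum_prime_recip:
  "convergent (\<lambda>N. (\<Sum>p\<le>N. prime_recip p) - ln (ln (real N)))"
proof -
  define A where "A = (\<lambda>N. \<Sum>p\<le>N. if prime p then ln (real p) / real p else 0)"
  obtain K where K: "\<And>N. N > 0 \<Longrightarrow> \<bar>A N - ln (real N)\<bar> \<le> K"
    using sum_ln_prime_over_prime_bounded unfolding A_def by metis
  \<comment> \<open>Indices are shifted by 2 so that all logarithms in denominators are
    positive.\<close>
  define R where "R = (\<lambda>n. A (n + 2) - ln (real (n + 2)))"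
  define b where "b = (\<lambda>n. 1 / ln (real (n + 2)))"
  have R: "\<bar>R n\<bar> \<le> K" for n using K[of "n + 2"] by (simp add: R_def)
  have bdec: "decseq b" unfolding b_def decseq_Suc_iff by (auto intro!: divide_left_mono mult_pos_pos)
  have blim: "b \<longlonglongrightarrow> 0" unfolding b_def by real_asymp
  define v where "v = (\<lambda>n. (ln (real (n + 3)) - ln (real (n + 2))) / ln (real (n + 3)) -
                          (ln (ln (real (n + 3))) - ln (ln (real (n + 2)))))"
  have v: "\<bar>v n\<bar> \<le> b n - b (Suc n)" for n
  proof -
    define x y where "x = ln (real (n + 2))" and "y = ln (real (n + 3))"
    have xy: "0 < x" "x \<le> y" "0 < y" by (auto simp: x_def y_def)
    have "y - x = ln (real (n + 3) / real (n + 2))" by (simp add: x_def y_def ln_div)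
    also have "\<dots> \<le> real (n + 3) / real (n + 2) - 1" by (rule ln_le_minus_one) simp
    also have "\<dots> \<le> 1" by (simp add: field_simps)
    finally have d: "y - x \<le> 1" .
    have l: "ln y - ln x = ln (y / x)" "ln x - ln y = ln (x / y)" using xy by (simp_all add: ln_div)
    \<comment> \<open>Both \<open>(y - x) / y\<close> and \<open>ln y - ln x\<close> lie between
      \<open>1 - x / y\<close> and \<open>y / x - 1\<close>, so they differ by at most the length of
      this interval.\<close>
    have "ln (y / x) \<le> y / x - 1" "ln (x / y) \<le> x / y - 1"
      using xy by (auto intro!: ln_le_minus_one)
    then have "\<bar>(y - x) / y - (ln y - ln x)\<bar> \<le> (y / x - 1) - (1 - x / y)"
      using l xy by (simp add: diff_divide_distrib)
    also have "\<dots> = (y - x) * (1 / x - 1 / y)" using xy by (simp add: field_simps)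
    also have "\<dots> \<le> 1 * (1 / x - 1 / y)"
      using d xy by (intro mult_right_mono) (auto simp: field_simps)
    also have "b n - b (Suc n) = 1 / x - 1 / y" by (simp add: b_def x_def y_def add.commute)
    ultimately show ?thesis by (simp add: v_def x_def y_def)
  qed
  have "summable v"
  proof (rule summable_comparison_test')
    show "summable (\<lambda>n. b n - b (Suc n))" by (rule telescope_summable'[OF blim])
  qed (use v in simp)
  then have "convergent (\<lambda>N. \<Sum>n<N. v n)" by (simp add: summable_iff_convergent)
  \<comment> \<open>The weighted increment of \<open>R\<close> is a prime reciprocal minus an
    increment of \<open>ln\<close> divided by \<open>ln\<close>. Adding \<open>v\<close> turns the
    latter into an increment of \<open>ln \<circ> ln\<close>, which telescopes.\<close>
  then have "convergent (\<lambda>N. (\<Sum>n<N. (R (Suc n) - R n) * b (Suc n)) + (\<Sum>n<N. v n))"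
    by (intro convergent_add convergent_sum_diff_mult[OF R bdec blim])
  also have "(\<lambda>N. (\<Sum>n<N. (R (Suc n) - R n) * b (Suc n)) + (\<Sum>n<N. v n)) =
      (\<lambda>N. ((\<Sum>p\<le>N+2. prime_recip p) - ln (ln (real (N+2)))) + (ln (ln 2) - (\<Sum>p\<le>2. prime_recip p)))"
  proof
    fix N
    show "(\<Sum>n<N. (R (Suc n) - R n) * b (Suc n)) + (\<Sum>n<N. v n) =
      ((\<Sum>p\<le>N+2. prime_recip p) - ln (ln (real (N+2)))) + (ln (ln 2) - (\<Sum>p\<le>2. prime_recip p))"
    proof (induction N)
      case (Suc N)
      define x y where "x = ln (real (N + 2))" and "y = ln (real (N + 3))"
      have y: "y > 0" by (simp add: y_def)
      have "A (Suc N + 2) = A (N + 2) + prime_recip (N + 3) * y"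
        by (simp add: A_def prime_recip_def y_def numeral_eq_Suc)
      then have R': "R (Suc N) - R N = prime_recip (N + 3) * y - (y - x)"
        by (simp add: R_def x_def y_def add.commute)
      have b': "b (Suc N) = 1 / y" by (simp add: b_def y_def add.commute)
      have "(R (Suc N) - R N) * b (Suc N) + v N = prime_recip (N + 3) - (ln y - ln x)"
        unfolding R' b' v_def x_def [symmetric] y_def [symmetric]
        using y by (simp add: diff_divide_distrib algebra_simps)
      then have "(R (Suc N) - R N) * b (Suc N) + v N =
          prime_recip (N + 3) - (ln (ln (real (N + 3))) - ln (ln (real (N + 2))))"
        by (simp add: x_def y_def)
      moreover have "(\<Sum>p\<le>Suc N + 2. prime_recip p) = (\<Sum>p\<le>N + 2. prime_recip p) + prime_recip (N + 3)"
        by (simp add: numeral_eq_Suc)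
      ultimately show ?case using Suc.IH by (simp add: add.commute add.left_commute)
    qed (simp add: numeral_2_eq_2)
  qed
  finally have "convergent (\<lambda>N. (\<Sum>p\<le>N+2. prime_recip p) - ln (ln (real (N+2))))"
    by (subst (asm) convergent_add_const_right_iff)
  then show ?thesis
    using convergent_ignore_initial_segment[of "\<lambda>N. (\<Sum>p\<le>N. prime_recip p) - ln (ln (real N))" 2] by simp
qed

section \<open>The comparison sequence on powers of two\<close>

text \<open>
  Since \<open>n = 2 ^ m\<close> means \<open>1 / m = ln 2 / ln n\<close>, the partial sums of this sequence are harmonic
  numbers of logarithms, and its Dirichlet series is a power series in \<open>2 powr - s\<close>.
\<close>
definition pow2_recip :: "nat \<Rightarrow> real" where
  "pow2_recip n = (if n \<in> range (\<lambda>m. 2 ^ Suc m) then ln 2 / ln (real n) else 0)"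

lemma pow2_recip_pow2: "pow2_recip (2 ^ Suc m) = 1 / real (Suc m)"
  by (simp add: pow2_recip_def ln_realpow del: power_Suc)

lemma sum_pow2_recip: "(\<Sum>n\<le>N. pow2_recip n) = harm (floor_log N)"
\<comment> \<open>\<open>2 ^ floor_log N \<le> N\<close> fails at 0, where \<open>floor_log\<close>
  is 0 by convention.\<close>
proof (cases "N = 0")
  case False
  have *: "2 ^ Suc m \<le> N \<longleftrightarrow> m < floor_log N" for m
  proof
    assume "2 ^ Suc m \<le> N"
    then have "floor_log (2 ^ Suc m) \<le> floor_log N" by (rule floor_log_le_iff)
    then show "m < floor_log N" by (simp only: floor_log_power Suc_le_eq)
  next
    assume "m < floor_log N"
    then have "(2::nat) ^ Suc m \<le> 2 ^ floor_log N" by (intro power_increasing) auto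
    also have "\<dots> \<le> N" using False by (intro floor_log_exp2_le) simp
    finally show "2 ^ Suc m \<le> N" .
  qed
  have "(\<Sum>n\<le>N. pow2_recip n) = (\<Sum>n\<in>(\<lambda>m. 2 ^ Suc m) ` {..<floor_log N}. pow2_recip n)"
    by (rule sum.mono_neutral_right) (auto simp: * pow2_recip_def simp del: power_Suc)
  also have "\<dots> = (\<Sum>m<floor_log N. pow2_recip (2 ^ Suc m))"
    by (subst sum.reindex) (auto intro!: inj_onI simp del: power_Suc)
  finally show ?thesis by (simp add: pow2_recip_pow2 harm_altdef inverse_eq_divide del: power_Suc)
qed (auto simp: pow2_recip_def harm_def)

text \<open>This is where Euler's constant enters. Since \<open>floor_log N\<close> is asymptotic to
  \<open>ln N / ln 2\<close>, its logarithm is \<open>ln (ln N) - ln (ln 2)\<close> up to a null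
  sequence.\<close>

lemma harm_floor_log_asymp:
  "(\<lambda>N. harm (floor_log N) - ln (ln (real N))) \<longlonglongrightarrow> euler_mascheroni - ln (ln 2)"
proof -
  have bounds: "log 2 (real N) - 1 \<le> real (floor_log N)" "real (floor_log N) \<le> log 2 (real N)"
    if "N \<ge> 1" for N
  proof -
    have "log 2 (real N) \<ge> 0" using that by simp
    then have "real (floor_log N) = of_int \<lfloor>log 2 (real N)\<rfloor>"
      using that by (simp add: floor_log_altdef)
    then show "log 2 (real N) - 1 \<le> real (floor_log N)" "real (floor_log N) \<le> log 2 (real N)"
      by linarith+
  qed
  have "filterlim (\<lambda>N. real (floor_log N)) at_top sequentially"
  proof (rule filterlim_at_top_mono)
    show "filterlim (\<lambda>N. log 2 (real N) - 1) at_top sequentially" by real_asymp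
    show "eventually (\<lambda>N. log 2 (real N) - 1 \<le> real (floor_log N)) sequentially"
      using eventually_ge_at_top[of 1] by eventually_elim (rule bounds)
  qed
  then have lim: "filterlim floor_log sequentially sequentially"
    by (simp add: filterlim_sequentially_iff_filterlim_real)
  have 1: "(\<lambda>N. harm (floor_log N) - ln (real (floor_log N))) \<longlonglongrightarrow> euler_mascheroni"
    using filterlim_compose[OF euler_mascheroni_LIMSEQ lim] by simp
  have ratio: "(\<lambda>N. real (floor_log N) / log 2 (real N)) \<longlonglongrightarrow> 1"
  proof (rule tendsto_sandwich)
    show "eventually (\<lambda>N. 1 - 1 / log 2 (real N) \<le> real (floor_log N) / log 2 (real N)) sequentially"
      using eventually_ge_at_top[of 2]
    proof eventually_elim
      case (elim N)
      then have l: "log 2 (real N) > 0" by simp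
      then have "1 - 1 / log 2 (real N) = (log 2 (real N) - 1) / log 2 (real N)"
        by (simp add: diff_divide_distrib)
      also have "\<dots> \<le> real (floor_log N) / log 2 (real N)"
        using bounds(1)[of N] l elim by (intro divide_right_mono) auto
      finally show ?case .
    qed
    show "eventually (\<lambda>N. real (floor_log N) / log 2 (real N) \<le> 1) sequentially"
      using eventually_ge_at_top[of 2]
    proof eventually_elim
      case (elim N)
      then have "log 2 (real N) > 0" by simp
      then show ?case using bounds(2)[of N] elim by (simp add: divide_le_eq_1)
    qed
    show "(\<lambda>N. 1 - 1 / log 2 (real N)) \<longlonglongrightarrow> 1" by real_asymp
  qed simp
  have 2: "(\<lambda>N. ln (real (floor_log N) / log 2 (real N))) \<longlonglongrightarrow> ln 1"
    by (intro tendsto_ln ratio) simp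
  have "(\<lambda>N. (harm (floor_log N) - ln (real (floor_log N))) +
      ln (real (floor_log N) / log 2 (real N)) - ln (ln 2)) \<longlonglongrightarrow> euler_mascheroni + ln 1 - ln (ln 2)"
    by (intro tendsto_intros 1 2)
  moreover have "eventually (\<lambda>N. (harm (floor_log N) - ln (real (floor_log N))) +
      ln (real (floor_log N) / log 2 (real N)) - ln (ln 2) = harm (floor_log N) - ln (ln (real N))) sequentially"
    using eventually_ge_at_top[of 4]
  proof eventually_elim
    case (elim N)
    have "log 2 4 \<le> log 2 (real N)" using elim by simp
    moreover have "log 2 4 = (2::real)" using log_pow_cancel[of 2 2] by simp
    ultimately have "floor_log N > 0" "log 2 (real N) > 0" using bounds(1)[of N] elim by auto
    then show ?case using elim by (simp add: ln_div ln_mult log_def)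
  qed
  ultimately show ?thesis by (simp add: tendsto_cong)
qed

section \<open>An Abelian theorem for Dirichlet series\<close>

text \<open>Summation by parts writes the error through the tails \<open>E\<close> of the series,
  weighted by the decrements of \<open>g s\<close>. Late tails are small; early ones are bounded,
  and the decrements there have small total because each \<open>g s n\<close> tends to 1. Together
  with the boundary term this gives three errors of \<open>\<epsilon> / 4\<close>.\<close>

lemma abel_limit_weights:
  fixes g :: "'a \<Rightarrow> nat \<Rightarrow> real"
  assumes d: "d sums L"
    and g: "eventually (\<lambda>s. g s 0 = 1 \<and> decseq (g s) \<and> (\<forall>n. 0 \<le> g s n) \<and> summable (\<lambda>n. d n * g s n)) F"
    and lim: "\<And>n. ((\<lambda>s. g s n) \<longlongrightarrow> 1) F"
  shows "((\<lambda>s. \<Sum>n. d n * g s n) \<longlongrightarrow> L) F"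
proof (rule tendstoI)
  fix \<epsilon> :: real assume \<epsilon>: "\<epsilon> > 0"
  define E where "E = (\<lambda>N. (\<Sum>k<N. d k) - L)"
  have Elim: "E \<longlonglongrightarrow> 0" using d unfolding E_def sums_def by (rule LIM_zero)
  then have "Bseq E" by (intro convergent_imp_Bseq convergentI)
  then obtain K where K: "K > 0" "\<And>n. \<bar>E n\<bar> \<le> K" unfolding Bseq_def by auto
  obtain N0 where N0: "\<And>n. n \<ge> N0 \<Longrightarrow> \<bar>E n\<bar> \<le> \<epsilon> / 4"
  proof -
    have "eventually (\<lambda>n. \<bar>E n\<bar> < \<epsilon> / 4) sequentially"
      using tendstoD[OF Elim, of "\<epsilon> / 4"] \<epsilon> by simp
    then show ?thesis using that unfolding eventually_sequentially by (meson less_imp_le)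
  qed
  \<comment> \<open>The weights start at 1, so their decrements over the first \<open>N0\<close>
    indices sum to \<open>1 - g s N0\<close>; multiplied by the bound \<open>K\<close> this stays
    below \<open>\<epsilon> / 4\<close>.\<close>
  have "eventually (\<lambda>s. dist (g s N0) 1 < \<epsilon> / (4 * K)) F"
    using \<epsilon> K by (intro tendstoD[OF lim]) auto
  with g show "eventually (\<lambda>s. dist (\<Sum>n. d n * g s n) L < \<epsilon>) F"
  proof eventually_elim
    case (elim s)
    define w where "w = (\<lambda>k. g s k - g s (Suc k))"
    have w0: "w k \<ge> 0" for k using elim by (simp add: w_def decseq_Suc_iff)
    have g1: "g s n \<le> 1" for n using elim decseqD[of "g s" 0 n] by simp
    have parts: "(\<Sum>k<N. d k * g s k) = E N * g s N + L + (\<Sum>k<N. E (Suc k) * w k)" for N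
    proof (induction N)
      case 0
      then show ?case using elim by (simp add: E_def)
    qed (simp add: E_def w_def algebra_simps)
    have bound: "\<bar>(\<Sum>k<N. d k * g s k) - L\<bar> \<le> 3 * \<epsilon> / 4" if N: "N \<ge> N0" for N
    proof -
      have "\<bar>E (Suc k)\<bar> * w k \<le> \<epsilon> / 4 * w k + (if k < N0 then K * w k else 0)" for k
      proof (cases "k < N0")
        case True
        have "\<bar>E (Suc k)\<bar> * w k \<le> K * w k" using K w0 by (intro mult_right_mono) auto
        then show ?thesis using True \<epsilon> w0[of k] by (simp add: add_increasing)
      next
        case False
        then have "\<bar>E (Suc k)\<bar> * w k \<le> \<epsilon> / 4 * w k"
          using N0[of "Suc k"] w0[of k] by (intro mult_right_mono) auto
        then show ?thesis using False by simp
      qed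
      then have "(\<Sum>k<N. \<bar>E (Suc k)\<bar> * w k) \<le> (\<Sum>k<N. \<epsilon> / 4 * w k + (if k < N0 then K * w k else 0))"
        by (intro sum_mono)
      also have "\<dots> = \<epsilon> / 4 * (\<Sum>k<N. w k) + (\<Sum>k<N. if k < N0 then K * w k else 0)"
        by (simp add: sum.distrib sum_distrib_left)
      also have "(\<Sum>k<N. if k < N0 then K * w k else 0) = (\<Sum>k<N0. K * w k)"
        using N by (intro sum.mono_neutral_cong_right) auto
      also have "\<dots> = K * (1 - g s N0)"
        using elim by (simp add: sum_distrib_left [symmetric] w_def sum_lessThan_telescope')
      also have "\<dots> \<le> K * (\<epsilon> / (4 * K))"
        using K elim by (intro mult_left_mono) (auto simp: dist_real_def)
      also have "\<dots> = \<epsilon> / 4" using K by simp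
      also have "(\<Sum>k<N. w k) = 1 - g s N" using elim by (simp add: w_def sum_lessThan_telescope')
      also have "\<epsilon> / 4 * (1 - g s N) \<le> \<epsilon> / 4 * 1" using \<epsilon> elim by (intro mult_left_mono) auto
      finally have S: "(\<Sum>k<N. \<bar>E (Suc k)\<bar> * w k) \<le> \<epsilon> / 2" by simp
      have "\<bar>\<Sum>k<N. E (Suc k) * w k\<bar> \<le> (\<Sum>k<N. \<bar>E (Suc k) * w k\<bar>)" by (rule sum_abs)
      also have "\<dots> = (\<Sum>k<N. \<bar>E (Suc k)\<bar> * w k)" using w0 by (simp add: abs_mult)
      finally have "\<bar>\<Sum>k<N. E (Suc k) * w k\<bar> \<le> \<epsilon> / 2" using S by simp
      moreover have "\<bar>E N * g s N\<bar> \<le> \<epsilon> / 4 * 1"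
        unfolding abs_mult using N0[OF N] g1[of N] elim \<epsilon> by (intro mult_mono) auto
      ultimately show ?thesis unfolding parts by linarith
    qed
    have "(\<lambda>N. \<Sum>k<N. d k * g s k) \<longlonglongrightarrow> (\<Sum>n. d n * g s n)"
      using elim by (simp add: summable_LIMSEQ)
    then have "(\<lambda>N. \<bar>(\<Sum>k<N. d k * g s k) - L\<bar>) \<longlonglongrightarrow> \<bar>(\<Sum>n. d n * g s n) - L\<bar>"
      by (intro tendsto_intros)
    then have "\<bar>(\<Sum>n. d n * g s n) - L\<bar> \<le> 3 * \<epsilon> / 4"
      using bound by (intro LIMSEQ_le_const2) auto
    then show ?case using \<epsilon> by (simp add: dist_real_def)
  qed
qed

text \<open>The series is shifted by one index before the weights are applied:
  \<open>0 powr - s\<close> is 0, so the unshifted weights would not decrease from 1.\<close>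

lemma abel_limit_dirichlet_series:
  fixes d :: "nat \<Rightarrow> real"
  assumes d: "d sums L" and d0: "d 0 = 0"
    and summ: "\<And>s. s > 0 \<Longrightarrow> summable (\<lambda>n. d n * real n powr - s)"
  shows "((\<lambda>s. \<Sum>n. d n * real n powr - s) \<longlongrightarrow> L) (at_right 0)"
proof -
  have "(\<lambda>n. d (Suc n)) sums L" using d d0 by (subst sums_Suc_iff) simp
  then have "((\<lambda>s. \<Sum>n. d (Suc n) * real (Suc n) powr - s) \<longlongrightarrow> L) (at_right 0)"
  proof (rule abel_limit_weights)
    have "eventually (\<lambda>s::real. s > 0) (at_right 0)" by (rule eventually_at_right_less)
    then show "eventually (\<lambda>s. real (Suc 0) powr - s = 1 \<and> decseq (\<lambda>n. real (Suc n) powr - s) \<and>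
       (\<forall>n. 0 \<le> real (Suc n) powr - s) \<and> summable (\<lambda>n. d (Suc n) * real (Suc n) powr - s)) (at_right 0)"
    proof eventually_elim
      case (elim s)
      have "summable (\<lambda>n. d (Suc n) * real (Suc n) powr - s)"
        using summ[OF elim] by (subst summable_Suc_iff)
      moreover have "decseq (\<lambda>n. real (Suc n) powr - s)"
        unfolding decseq_Suc_iff using elim by (auto intro!: powr_mono2')
      ultimately show ?case by simp
    qed
    fix n
    have "((\<lambda>s. real (Suc n) powr - s) \<longlongrightarrow> real (Suc n) powr - 0) (at_right 0)"
      by (intro tendsto_intros) auto
    then show "((\<lambda>s. real (Suc n) powr - s) \<longlongrightarrow> 1) (at_right 0)" by simp
  qed
  moreover have "eventually (\<lambda>s. (\<Sum>n. d (Suc n) * real (Suc n) powr - s) = (\<Sum>n. d n * real n powr - s)) (at_right 0)"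
    using eventually_at_right_less[of "0::real"]
  proof eventually_elim
    case (elim s)
    show ?case using suminf_split_head[OF summ[OF elim]] d0 by simp
  qed
  ultimately show ?thesis by (simp add: tendsto_cong)
qed

section \<open>The zeta function to the right of 1\<close>

text \<open>The mean value theorem for \<open>x powr - s\<close>; summed over the integers it takes
  the place of the integral test.\<close>

lemma powr_diff_bounds:
  fixes x s :: real
  assumes "x \<ge> 1" "s > 0"
  shows "x powr - s - (x + 1) powr - s \<le> s * x powr - (1 + s)"
    and "s * (x + 1) powr - (1 + s) \<le> x powr - s - (x + 1) powr - s"
proof -
  have "\<exists>z::real. x < z \<and> z < x + 1 \<and> (x + 1) powr - s - x powr - s = (x + 1 - x) * (- s * z powr (- s - 1))"
    using assms by (intro MVT2) (auto intro!: derivative_eq_intros)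
  then obtain z where z12: "x < z" "z < x + 1"
    and z': "(x + 1) powr - s - x powr - s = (x + 1 - x) * (- s * z powr (- s - 1))" by blast
  have e: "- s - 1 = - (1 + s)" by simp
  have z: "x < z" "z < x + 1" "x powr - s - (x + 1) powr - s = s * z powr - (1 + s)"
    using z12 z' unfolding e by simp_all
  have "z powr - (1 + s) \<le> x powr - (1 + s)" "(x + 1) powr - (1 + s) \<le> z powr - (1 + s)"
    using assms z by (auto intro!: powr_mono2')
  then show "x powr - s - (x + 1) powr - s \<le> s * x powr - (1 + s)"
    "s * (x + 1) powr - (1 + s) \<le> x powr - s - (x + 1) powr - s"
    unfolding z(3) using assms by (auto intro!: mult_left_mono)
qed

lemma summable_nat_powr: "s > 0 \<Longrightarrow> summable (\<lambda>n. real n powr - (1 + s))"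
  by (simp add: summable_real_powr_iff)

text \<open>The differences \<open>n powr - s - (n + 1) powr - s\<close> telescope to 1, and term by
  term they lie between \<open>s\<close> times consecutive terms of the zeta series. As
  \<open>s\<close> tends to 0 this gives the residue 1 of zeta.\<close>

lemma zeta_bounds:
  assumes s: "s > 0"
  defines "Z \<equiv> (\<Sum>n. real n powr - (1 + s))"
  shows "1 \<le> s * Z" "s * Z \<le> 1 + s"
proof -
  define f where "f = (\<lambda>n. real n powr - (1 + s))"
  define t where "t = (\<lambda>n. real (Suc n) powr - s)"
  have "t \<longlonglongrightarrow> 0" unfolding t_def using s by real_asymp
  then have t: "(\<lambda>n. t n - t (Suc n)) sums 1"
    using telescope_sums'[of t 0] by (simp add: t_def)
  have f: "f sums Z" unfolding Z_def f_def using summable_nat_powr[OF s] by (rule summable_sums)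
  have f1: "(\<lambda>n. f (Suc n)) sums Z" using f by (subst sums_Suc_iff) (simp add: f_def)
  have f2: "(\<lambda>n. f (Suc (Suc n))) sums (Z - 1)"
    using f1 by (subst sums_Suc_iff) (simp add: f_def)
  have b: "t n - t (Suc n) \<le> s * f (Suc n)" "s * f (Suc (Suc n)) \<le> t n - t (Suc n)" for n
    using powr_diff_bounds[of "real (Suc n)" s] s by (simp_all add: t_def f_def add.commute)
  show "1 \<le> s * Z" using sums_le[OF b(1) t sums_mult[OF f1, of s]] .
  have "s * (Z - 1) \<le> 1" using sums_le[OF b(2) sums_mult[OF f2, of s] t] .
  then show "s * Z \<le> 1 + s" by (simp add: algebra_simps)
qed

text \<open>Sieving by a prime \<open>p\<close> removes from the sum its multiple by \<open>f p\<close>.\<close>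
lemma infsum_sieve_primes:
  fixes f :: "nat \<Rightarrow> real"
  assumes mult: "\<And>m n. f (m * n) = f m * f n" and summ: "f summable_on UNIV"
    and P: "finite P" "\<And>p. p \<in> P \<Longrightarrow> prime p"
  shows "infsum f {n. \<forall>p\<in>P. \<not> p dvd n} = infsum f UNIV * (\<Prod>p\<in>P. 1 - f p)"
  using P
proof (induction P rule: finite_induct)
  case (insert p P)
  have p: "prime p" using insert by auto
  define C where "C = (\<lambda>P::nat set. {n. \<forall>p\<in>P. \<not> p dvd n})"
  have summ': "f summable_on A" for A using summ summable_on_subset_banach by blast
  \<comment> \<open>Multiplication by \<open>p\<close>, a prime outside \<open>P\<close>, does not
    affect divisibility by the primes in \<open>P\<close>.\<close>
  have "C P = C (insert p P) \<union> (*) p ` C P"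
  proof (intro equalityI subsetI)
    fix n assume n: "n \<in> C P"
    show "n \<in> C (insert p P) \<union> (*) p ` C P"
    proof (cases "p dvd n")
      case True
      then obtain m where m: "n = p * m" by auto
      then have "m \<in> C P" using n by (auto simp: C_def)
      then show ?thesis using m by blast
    qed (use n in \<open>auto simp: C_def\<close>)
  next
    fix n assume "n \<in> C (insert p P) \<union> (*) p ` C P"
    then show "n \<in> C P"
    proof
      assume "n \<in> (*) p ` C P"
      then obtain m where m: "m \<in> C P" "n = p * m" by auto
      show ?thesis unfolding C_def
      proof (intro CollectI ballI notI)
        fix q assume q: "q \<in> P" "q dvd n"
        then have "q dvd p \<or> q dvd m" using insert.prems[of q] m by (simp add: prime_dvd_mult_iff)
        moreover have "\<not> q dvd p"
          using q insert.prems[of q] p insert.hyps primes_dvd_imp_eq[of q p] by auto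
        moreover have "\<not> q dvd m" using q m by (auto simp: C_def)
        ultimately show False by blast
      qed
    qed (auto simp: C_def)
  qed
  moreover have "C (insert p P) \<inter> (*) p ` C P = {}" by (auto simp: C_def)
  ultimately have "infsum f (C P) = infsum f (C (insert p P)) + infsum f ((*) p ` C P)"
    using infsum_Un_disjoint[OF summ' summ'] by metis
  also have "infsum f ((*) p ` C P) = infsum (f \<circ> (*) p) (C P)"
    using p prime_gt_0_nat by (intro infsum_reindex inj_onI) auto
  also have "\<dots> = f p * infsum f (C P)"
    by (simp add: o_def mult infsum_cmult_right')
  finally have "infsum f (C P) = infsum f (C (insert p P)) + f p * infsum f (C P)" .
  moreover have "infsum f (C P) * (1 - f p) = infsum f (C P) - f p * infsum f (C P)"
    by (simp add: algebra_simps)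
  ultimately have "infsum f (C (insert p P)) = infsum f (C P) * (1 - f p)" by linarith
  then show ?case using insert by (simp add: C_def algebra_simps)
qed simp

text \<open>After sieving by all primes up to \<open>N\<close>, the sum retains
  \<open>f 1 = 1\<close> and otherwise only terms beyond \<open>N\<close> (the one at 0 vanishes),
  so it lies between 1 and 1 plus a tail.\<close>

lemma euler_product_limit:
  fixes f :: "nat \<Rightarrow> real"
  assumes mult: "\<And>m n. f (m * n) = f m * f n" and summ: "summable f"
    and nonneg: "\<And>n. f n \<ge> 0" and f01: "f 0 = 0" "f 1 = 1"
  shows "(\<lambda>N. suminf f * (\<Prod>p | p \<le> N \<and> prime p. 1 - f p)) \<longlonglongrightarrow> 1"
proof -
  have son: "f summable_on UNIV" using summ nonneg by (simp add: summable_on_UNIV_nonneg_real_iff)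
  have summ': "f summable_on A" for A using son summable_on_subset_banach by blast
  have Z: "infsum f UNIV = suminf f"
    using summ nonneg by (intro infsumI sums_nonneg_imp_has_sum summable_sums) auto
  define C where "C = (\<lambda>N. {n. \<forall>p\<in>{p. p \<le> N \<and> prime p}. \<not> p dvd (n::nat)})"
  have eq: "suminf f * (\<Prod>p | p \<le> N \<and> prime p. 1 - f p) = infsum f (C N)" for N
    unfolding C_def Z [symmetric] by (rule infsum_sieve_primes[OF mult son, symmetric]) auto
  show ?thesis unfolding eq
  proof (rule tendsto_sandwich)
    have "1 \<le> infsum f (C N)" for N
    proof -
      have "infsum f {1} \<le> infsum f (C N)"
        using summ' nonneg by (intro infsum_mono2) (auto simp: C_def)
      then show ?thesis using f01 by simp
    qed
    then show "eventually (\<lambda>N. 1 \<le> infsum f (C N)) sequentially" by simp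
    show "eventually (\<lambda>N. infsum f (C N) \<le> suminf f - (\<Sum>n<Suc N. f n) + 1) sequentially"
      using eventually_ge_at_top[of 1]
    proof eventually_elim
      case (elim N)
      have "C N \<inter> {2..N} = {}"
      proof -
        have "n \<notin> C N" if n: "n \<in> {2..N}" for n
        proof -
          have "n \<noteq> 1" using n by simp
          then obtain p where p: "prime p" "p dvd n" using prime_factor_nat by blast
          then have "p \<le> N" using n dvd_imp_le[of p n] by simp
          then show ?thesis using p by (auto simp: C_def)
        qed
        then show ?thesis by blast
      qed
      then have "infsum f (C N) + infsum f {2..N} = infsum f (C N \<union> {2..N})"
        by (intro infsum_Un_disjoint [symmetric] summ')
      also have "\<dots> \<le> infsum f UNIV" using nonneg by (intro infsum_mono2 summ') auto
      finally have "infsum f (C N) \<le> suminf f - sum f {2..N}" by (simp add: Z)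
      moreover have "(\<Sum>n<Suc N. f n) = sum f {2..N} + 1"
      proof -
        have "{..<Suc N} = insert 0 (insert 1 {2..N})" using elim by auto
        then show ?thesis using f01 by simp
      qed
      ultimately show ?case by simp
    qed
    have "(\<lambda>N. \<Sum>n<Suc N. f n) \<longlonglongrightarrow> suminf f"
      using summ by (intro LIMSEQ_Suc) (rule summable_LIMSEQ)
    then have "(\<lambda>N. suminf f - (\<Sum>n<Suc N. f n) + 1) \<longlonglongrightarrow> suminf f - suminf f + 1"
      by (intro tendsto_intros)
    then show "(\<lambda>N. suminf f - (\<Sum>n<Suc N. f n) + 1) \<longlonglongrightarrow> 1" by simp
  qed simp
qed

lemma ln_zeta_sums:
  assumes s: "s > 0"
  shows "(\<lambda>p. if prime p then - ln (1 - real p powr - (1 + s)) else 0)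
           sums ln (\<Sum>n. real n powr - (1 + s))"
proof -
  define f where "f = (\<lambda>n. real n powr - (1 + s))"
  define Z where "Z = suminf f"
  have lim: "(\<lambda>N. Z * (\<Prod>p | p \<le> N \<and> prime p. 1 - f p)) \<longlonglongrightarrow> 1"
    unfolding Z_def
  proof (rule euler_product_limit)
    show "summable f" unfolding f_def by (rule summable_nat_powr[OF s])
    show "f (m * n) = f m * f n" for m n by (simp add: f_def powr_mult)
  qed (auto simp: f_def)
  have Z0: "Z > 0" using zeta_bounds(1)[OF s] s unfolding Z_def f_def
    by (metis less_le_trans zero_less_mult_pos zero_less_one)
  have f1: "f p < 1" if "prime p" for p
  proof -
    have "real p powr - (1 + s) < real p powr 0" using that s prime_gt_1_nat[OF that] by (intro powr_less_mono) auto
    then show ?thesis using that prime_gt_0_nat by (simp add: f_def)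
  qed
  have "(\<lambda>N. ln Z - ln (Z * (\<Prod>p | p \<le> N \<and> prime p. 1 - f p))) \<longlonglongrightarrow> ln Z - ln 1"
    by (intro tendsto_diff tendsto_const tendsto_ln lim) simp
  moreover have "ln Z - ln (Z * (\<Prod>p | p \<le> N \<and> prime p. 1 - f p)) =
      (\<Sum>p\<le>N. if prime p then - ln (1 - f p) else 0)" for N
  proof -
    define Q where "Q = (\<Prod>p | p \<le> N \<and> prime p. 1 - f p)"
    have pos: "Q > 0" unfolding Q_def using f1 by (intro prod_pos) auto
    have "(\<Sum>p\<le>N. if prime p then - ln (1 - f p) else 0) = (\<Sum>p | p \<le> N \<and> prime p. - ln (1 - f p))"
      by (intro sum.mono_neutral_cong_right) auto
    also have "\<dots> = - ln Q"
      unfolding Q_def by (subst ln_prod) (auto simp: sum_negf dest!: f1)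
    also have "\<dots> = ln Z - ln (Z * Q)"
      using pos Z0 by (simp add: ln_mult)
    finally show ?thesis by (simp add: Q_def)
  qed
  ultimately show ?thesis unfolding sums_def_le f_def Z_def by simp
qed

text \<open>The logarithm series at \<open>2 powr - s\<close>, spread out along the powers of
  two.\<close>

lemma pow2_recip_dirichlet_series:
  assumes s: "s > 0"
  shows "(\<lambda>n. pow2_recip n * real n powr - s) sums (- ln (1 - 2 powr - s))"
proof -
  define x :: real where "x = 2 powr - s"
  have x: "0 < x" "x < 1" using s powr_less_mono[of "-s" 0 2] by (auto simp: x_def)
  have "(\<lambda>n. - ((- (- x)) ^ n) / of_nat n) sums ln (1 + (- x))" using x by (intro Complex_Transcendental.ln_series') auto
  then have "(\<lambda>n. - (- (x ^ n) / real n)) sums (- ln (1 - x))" by (intro sums_minus) simp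
  \<comment> \<open>The term at index 0 is a division by zero, hence 0, and drops out.\<close>
  then have "(\<lambda>n. x ^ Suc n / real (Suc n)) sums (- ln (1 - x))"
    by (subst sums_Suc_iff) simp
  moreover have "pow2_recip (2 ^ Suc m) * real (2 ^ Suc m) powr - s = x ^ Suc m / real (Suc m)" for m
  proof -
    have "real (2 ^ Suc m) powr - s = (2 powr real (Suc m)) powr - s"
      by (simp only: powr_realpow of_nat_power of_nat_numeral zero_less_numeral)
    also have "\<dots> = x powr real (Suc m)" by (simp only: powr_powr x_def mult.commute)
    also have "\<dots> = x ^ Suc m" using x by (simp only: powr_realpow)
    finally show ?thesis unfolding pow2_recip_pow2 by simp
  qed
  ultimately have "(\<lambda>m. pow2_recip (2 ^ Suc m) * real (2 ^ Suc m) powr - s) sums (- ln (1 - x))"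
    by simp
  moreover have "strict_mono (\<lambda>m. 2 ^ Suc m :: nat)" by (intro strict_monoI_Suc) simp
  ultimately show ?thesis unfolding x_def [symmetric]
    using sums_mono_reindex[of "\<lambda>m. 2 ^ Suc m" "\<lambda>n. pow2_recip n * real n powr - s"]
    by (simp add: pow2_recip_def)
qed

text \<open>The part of the logarithm series from \<open>x^2 / 2\<close> on; at
  \<open>x = p powr - (1 + s)\<close> it collects the higher powers of \<open>p\<close> in
  \<open>ln \<zeta>(1+s)\<close>.\<close>

definition ln_defect :: "real \<Rightarrow> real" where "ln_defect x = - ln (1 - x) - x"

lemma ln_defect_bounds:
  assumes "0 \<le> x" "x \<le> 1/2"
  shows "0 \<le> ln_defect x" "ln_defect x \<le> 2 * x\<^sup>2"
  using ln_one_minus_pos_lower_bound[OF assms] ln_le_minus_one[of "1 - x"] assms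
  by (auto simp: ln_defect_def)

text \<open>The partial sums \<open>D\<close> converge to some \<open>L\<close>, and the Abelian
  theorem identifies \<open>L\<close> as \<open>ln (ln 2) - B\<close>. Both \<open>B\<close> and
  \<open>ln (ln 2)\<close> cancel when \<open>- ln (1 - 1 / p)\<close> is reassembled from
  \<open>1 / p\<close> and its defect, leaving only Euler's constant.\<close>

theorem mertens_third:
  "(\<lambda>N. (\<Prod>p | p \<le> N \<and> prime p. 1 - 1 / real p) * ln (real N)) \<longlonglongrightarrow> exp (- euler_mascheroni)"
proof -
  define d where "d = (\<lambda>n. prime_recip n - pow2_recip n)"
  define D where "D = (\<lambda>N. \<Sum>n\<le>N. d n)"
  have D: "D N = ((\<Sum>p\<le>N. prime_recip p) - ln (ln (real N))) - (harm (floor_log N) - ln (ln (real N)))" for N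
    by (simp add: D_def d_def sum_subtractf sum_pow2_recip)
  have "convergent (\<lambda>N. harm (floor_log N) - ln (ln (real N)) :: real)"
    using harm_floor_log_asymp by (rule convergentI)
  then have "convergent D" unfolding D by (rule convergent_diff[OF convergent_sum_prime_recip])
  then obtain L where L: "D \<longlonglongrightarrow> L" by (auto simp: convergent_def)
  then have dL: "d sums L" by (simp add: sums_def_le D_def)
  have d0: "d 0 = 0" by (simp add: d_def prime_recip_def pow2_recip_def)
  define a where "a = (\<lambda>k (s::real). if prime k then ln_defect (real k powr - (1 + s)) else 0)"
  define B where "B = (\<Sum>k. if prime k then ln_defect (1 / real k) else 0)"
  have powr_le: "real k powr - (1 + s) \<le> 1 / real k" if "prime k" "s \<ge> 0" for k s
  proof -
    have "real k powr - (1 + s) \<le> real k powr - 1"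
      using that prime_gt_0_nat[OF that(1)] by (intro powr_mono) auto
    then show ?thesis using prime_gt_0_nat[OF that(1)] by (simp add: powr_minus_divide)
  qed
  have recip_le: "1 / real k \<le> 1 / 2" if "prime k" for k
    using prime_ge_2_nat[OF that] by (simp add: field_simps)
  have a_bound: "norm (a k s) \<le> 2 * inverse (real k ^ 2)" if "s \<ge> 0" for k s
  proof (cases "prime k")
    case True
    define x where "x = real k powr - (1 + s)"
    have x: "0 \<le> x" "x \<le> 1 / real k" using powr_le[OF True that] by (auto simp: x_def)
    then have "0 \<le> ln_defect x" "ln_defect x \<le> 2 * x\<^sup>2"
      using recip_le[OF True] by (intro ln_defect_bounds; linarith)+
    moreover have "x\<^sup>2 \<le> (1 / real k)\<^sup>2" using x by (intro power_mono)
    ultimately show ?thesis using True by (simp add: a_def x_def power_divide inverse_eq_divide)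
  qed (simp add: a_def)
  \<comment> \<open>Tannery's theorem takes the limit \<open>s \<rightarrow> 0\<close> under the
    sum; the common majorant \<open>2 / k^2\<close> comes from
    \<open>ln_defect_bounds\<close>.\<close>
  have tann: "eventually (\<lambda>s. summable (\<lambda>k. norm (a k s))) (at_right 0) \<and>
      summable (\<lambda>k. norm (if prime k then ln_defect (1 / real k) else 0)) \<and>
      ((\<lambda>s. \<Sum>k. a k s) \<longlongrightarrow> B) (at_right 0)"
    unfolding B_def
  proof (rule tannerys_theorem)
    fix k :: nat
    show "((\<lambda>s. a k s) \<longlongrightarrow> (if prime k then ln_defect (1 / real k) else 0)) (at_right 0)"
    proof (cases "prime k")
      case True
      then have k: "real k \<ge> 2" using prime_ge_2_nat[OF True] by simp
      have "((\<lambda>s. ln_defect (real k powr - (1 + s))) \<longlongrightarrow> ln_defect (real k powr - (1 + 0))) (at_right 0)"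
        unfolding ln_defect_def using k by (intro tendsto_intros) (auto simp: powr_minus_divide)
      then show ?thesis using True k by (simp add: a_def powr_minus_divide)
    qed (simp add: a_def)
  next
    have "eventually (\<lambda>s::real. s \<ge> 0) (at_right 0)"
      using eventually_at_right_less[of "0::real"] by eventually_elim simp
    then have "eventually (\<lambda>(k::nat, s::real). s \<ge> 0) (at_top \<times>\<^sub>F at_right 0)"
      by (subst eventually_prod2) auto
    then show "eventually (\<lambda>(k, s). norm (a k s) \<le> 2 * inverse (real k ^ 2)) (at_top \<times>\<^sub>F at_right 0)"
      by eventually_elim (auto intro!: a_bound [unfolded real_norm_def])
    show "summable (\<lambda>k. 2 * inverse (real k ^ 2))" by (intro summable_mult inverse_power_summable) simp
  qed simp
  have series: "(\<lambda>n. d n * real n powr - s) sums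
      (ln (\<Sum>n. real n powr - (1 + s)) - (\<Sum>k. a k s) + ln (1 - 2 powr - s))" if s: "s > 0" for s
  proof -
    have "summable (\<lambda>k. a k s)"
    proof (rule summable_comparison_test')
      show "summable (\<lambda>k. 2 * inverse (real k ^ 2))" by (intro summable_mult inverse_power_summable) simp
    qed (use a_bound s in simp)
    then have "(\<lambda>k. (if prime k then - ln (1 - real k powr - (1 + s)) else 0) - a k s -
        pow2_recip k * real k powr - s) sums
      (ln (\<Sum>n. real n powr - (1 + s)) - (\<Sum>k. a k s) - (- ln (1 - 2 powr - s)))"
      by (intro sums_diff ln_zeta_sums pow2_recip_dirichlet_series s summable_sums)
    moreover have "(if prime k then - ln (1 - real k powr - (1 + s)) else 0) - a k s -
        pow2_recip k * real k powr - s = d k * real k powr - s" for k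
    proof -
      have "real k powr - (1 + s) = 1 / real k * real k powr - s" if "k > 0"
        using that by (simp add: powr_diff powr_minus_divide)
      then show ?thesis using prime_gt_0_nat[of k]
        by (auto simp: a_def d_def ln_defect_def prime_recip_def algebra_simps)
    qed
    ultimately show ?thesis by simp
  qed
  have "((\<lambda>s. \<Sum>n. d n * real n powr - s) \<longlongrightarrow> L) (at_right 0)"
    using dL d0 by (rule abel_limit_dirichlet_series) (rule sums_summable[OF series])
  moreover have "((\<lambda>s. \<Sum>n. d n * real n powr - s) \<longlongrightarrow> ln (ln 2) - B) (at_right 0)"
  proof -
    have zeta: "((\<lambda>s. s * (\<Sum>n. real n powr - (1 + s))) \<longlongrightarrow> 1) (at_right 0)"
    proof (rule tendsto_sandwich)
      show "eventually (\<lambda>s. 1 \<le> s * (\<Sum>n. real n powr - (1 + s))) (at_right 0)"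
        using eventually_at_right_less[of "0::real"] by eventually_elim (rule zeta_bounds)
      show "eventually (\<lambda>s. s * (\<Sum>n. real n powr - (1 + s)) \<le> 1 + s) (at_right 0)"
        using eventually_at_right_less[of "0::real"] by eventually_elim (rule zeta_bounds)
      have "((\<lambda>s::real. 1 + s) \<longlongrightarrow> 1 + 0) (at_right 0)" by (intro tendsto_intros)
      then show "((\<lambda>s::real. 1 + s) \<longlongrightarrow> 1) (at_right 0)" by simp
    qed simp
    have two: "((\<lambda>s. (1 - 2 powr - s) / s) \<longlongrightarrow> ln (2::real)) (at_right 0)" by real_asymp
    \<comment> \<open>Moving a factor \<open>s\<close> from one logarithm to the other cancels the
      two singularities, so that each term has a finite limit.\<close>
    have "((\<lambda>s. ln (s * (\<Sum>n. real n powr - (1 + s))) - (\<Sum>k. a k s) + ln ((1 - 2 powr - s) / s))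
        \<longlongrightarrow> ln 1 - B + ln (ln 2)) (at_right 0)"
      using tann by (intro tendsto_add tendsto_diff tendsto_ln zeta two) auto
    moreover have "eventually (\<lambda>s. ln (s * (\<Sum>n. real n powr - (1 + s))) - (\<Sum>k. a k s) + ln ((1 - 2 powr - s) / s)
        = (\<Sum>n. d n * real n powr - s)) (at_right 0)"
      using eventually_at_right_less[of "0::real"]
    proof eventually_elim
      case (elim s)
      define Z where "Z = (\<Sum>n. real n powr - (1 + s))"
      have "s * Z > 0" using zeta_bounds(1)[OF elim] unfolding Z_def by linarith
      then have Z: "Z > 0" using elim by (simp add: zero_less_mult_iff)
      have "2 powr - s < (1::real)" using elim powr_less_mono[of "-s" 0 2] by simp
      then have "ln (s * Z) - (\<Sum>k. a k s) + ln ((1 - 2 powr - s) / s) =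
          ln Z - (\<Sum>k. a k s) + ln (1 - 2 powr - s)"
        using elim Z by (simp add: ln_mult ln_div)
      then show ?case using sums_unique[OF series[OF elim]] by (simp add: Z_def)
    qed
    ultimately show ?thesis by (simp add: tendsto_cong)
  qed
  ultimately have Leq: "L = ln (ln 2) - B" using tendsto_unique[of "at_right (0::real)"] by simp
  have "summable (\<lambda>k. if prime k then ln_defect (1 / real k) else 0)"
    by (rule summable_norm_cancel[OF conjunct1[OF conjunct2[OF tann]]])
  then have Bsum: "(\<lambda>N. \<Sum>k\<le>N. if prime k then ln_defect (1 / real k) else 0) \<longlonglongrightarrow> B"
    unfolding B_def by (rule summable_LIMSEQ')
  \<comment> \<open>The harmonic comparison term that was subtracted in \<open>D\<close> is added
    back, now with its known limit.\<close>
  have "(\<lambda>N. exp (- (D N + (harm (floor_log N) - ln (ln (real N))) +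
        (\<Sum>k\<le>N. if prime k then ln_defect (1 / real k) else 0)))) \<longlonglongrightarrow>
      exp (- (L + (euler_mascheroni - ln (ln 2)) + B))"
    by (intro tendsto_intros L harm_floor_log_asymp Bsum)
  moreover have "eventually (\<lambda>N. exp (- (D N + (harm (floor_log N) - ln (ln (real N))) +
        (\<Sum>k\<le>N. if prime k then ln_defect (1 / real k) else 0))) =
      (\<Prod>p | p \<le> N \<and> prime p. 1 - 1 / real p) * ln (real N)) sequentially"
    using eventually_ge_at_top[of 2]
  proof eventually_elim
    case (elim N)
    have "(\<Sum>p\<le>N. prime_recip p) + (\<Sum>k\<le>N. if prime k then ln_defect (1 / real k) else 0) =
        (\<Sum>p | p \<le> N \<and> prime p. - ln (1 - 1 / real p))"
      unfolding sum.distrib [symmetric]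
      by (intro sum.mono_neutral_cong_right) (auto simp: prime_recip_def ln_defect_def)
    then have "- (D N + (harm (floor_log N) - ln (ln (real N))) +
        (\<Sum>k\<le>N. if prime k then ln_defect (1 / real k) else 0)) =
        (\<Sum>p | p \<le> N \<and> prime p. ln (1 - 1 / real p)) + ln (ln (real N))"
      unfolding D by (simp add: sum_negf)
    also have "exp \<dots> = (\<Prod>p | p \<le> N \<and> prime p. exp (ln (1 - 1 / real p))) * ln (real N)"
      using elim by (simp add: exp_add exp_sum)
    also have "(\<Prod>p | p \<le> N \<and> prime p. exp (ln (1 - 1 / real p))) = (\<Prod>p | p \<le> N \<and> prime p. 1 - 1 / real p)"
    proof (intro prod.cong refl)
      fix p assume "p \<in> {p. p \<le> N \<and> prime p}"
      then show "exp (ln (1 - 1 / real p)) = 1 - 1 / real p" using recip_le[of p] by simp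
    qed
    finally show ?case .
  qed
  ultimately have "(\<lambda>N. (\<Prod>p | p \<le> N \<and> prime p. 1 - 1 / real p) * ln (real N)) \<longlonglongrightarrow>
      exp (- (L + (euler_mascheroni - ln (ln 2)) + B))"
    by (rule Lim_transform_eventually)
  then show ?thesis by (simp add: Leq)
qed

section \<open>The limit inferior\<close>

text \<open>The least factor that \<open>p\<close> can contribute for an admissible
  \<open>n\<close>. If 2 divides such an \<open>n\<close> then so does 4, which makes the factor at
  2 equal to \<open>1 / 2\<close>; for odd \<open>p\<close> the minimum occurs when \<open>p\<close>
  divides \<open>n\<close> exactly once.\<close>

definition local_proportion :: "nat \<Rightarrow> real" where
  "local_proportion p = (if p = 2 then 1 / 2 else 1 - 1 / (real p - 1))"

definition local_proportion_prod :: "nat \<Rightarrow> real" where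
  "local_proportion_prod N = (\<Prod>p | p \<le> N \<and> prime p. local_proportion p)"

lemma local_proportion_bounds:
  assumes "prime p"
  shows "0 < local_proportion p" "local_proportion p \<le> 1"
proof -
  have "p \<ge> 2" using assms by (rule prime_ge_2_nat)
  then show "0 < local_proportion p" "local_proportion p \<le> 1"
    by (cases "p = 2"; simp add: local_proportion_def)+
qed

text \<open>Each local factor is the corresponding factor of the twin prime constant times
  \<open>1 - 1 / p\<close>; at 2 the former is 1.\<close>

lemma local_proportion_prod_asymp:
  "(\<lambda>N. local_proportion_prod N * ln (real N)) \<longlonglongrightarrow> twin_prime_const * exp (- euler_mascheroni)"
proof -
  define t where "t = (\<lambda>p. if prime p \<and> p > 2 then real p * (real p - 2) / (real p - 1)\<^sup>2 else 1)"
  have "convergent_prod t"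
    unfolding t_def by (rule abs_convergent_prod_imp_convergent_prod[OF abs_convergent_twin_prime_prod])
  then have t: "(\<lambda>N. \<Prod>p\<le>N. t p) \<longlonglongrightarrow> twin_prime_const"
    unfolding twin_prime_const_def t_def by (rule convergent_prod_LIMSEQ)
  have "local_proportion_prod N = (\<Prod>p\<le>N. t p) * (\<Prod>p | p \<le> N \<and> prime p. 1 - 1 / real p)" for N
  proof -
    have "(\<Prod>p\<le>N. t p) = (\<Prod>p | p \<le> N \<and> prime p. t p)"
      by (intro prod.mono_neutral_right) (auto simp: t_def)
    moreover have "local_proportion p = t p * (1 - 1 / real p)" if "prime p" for p
    proof (cases "p = 2")
      case False
      then have "p > 2" using prime_ge_2_nat[OF that] by simp
      define x where "x = real p"
      have "x > 2" using \<open>p > 2\<close> by (simp add: x_def)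
      then have "1 - 1 / (x - 1) = (x - 2) / (x - 1)" "1 - 1 / x = (x - 1) / x"
        by (simp_all add: field_simps)
      then have "1 - 1 / (x - 1) = x * (x - 2) / (x - 1)\<^sup>2 * (1 - 1 / x)"
        using \<open>x > 2\<close> by (simp add: power2_eq_square)
      then show ?thesis using that \<open>p > 2\<close> by (simp add: local_proportion_def t_def x_def)
    qed (simp add: local_proportion_def t_def)
    then have "local_proportion_prod N = (\<Prod>p | p \<le> N \<and> prime p. t p * (1 - 1 / real p))"
      unfolding local_proportion_prod_def by (intro prod.cong) auto
    ultimately show ?thesis by (simp add: prod.distrib)
  qed
  then show ?thesis using tendsto_mult[OF t mertens_third] by (simp add: mult.assoc)
qed

text \<open>
  The prime factors up to \<open>y = \<lfloor>ln n\<rfloor>\<close> contribute at least the full product over all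
  primes up to \<open>y\<close>; there are at most \<open>ln n / ln y\<close> larger ones, each costing a factor at least
  \<open>1 - 1 / y\<close>.
\<close>
lemma primitive_proportion_ge:
  fixes n :: nat
  defines "y \<equiv> nat \<lfloor>ln (real n)\<rfloor>"
  assumes n: "\<not> [n = 2] (mod 4)" and y: "y \<ge> 2"
  shows "local_proportion_prod y * (1 - (real y + 1) / (real y * ln (real y))) \<le> primitive_proportion n"
proof -
  have n0: "n > 0" using y by (cases "n = 0") (auto simp: y_def)
  define A B where "A = {p \<in> prime_factors n. p \<le> y}" and "B = {p \<in> prime_factors n. p > y}"
  have fin: "finite A" "finite B" by (auto simp: A_def B_def)
  have lny: "ln (real y) > 0" using y by simp
  have "local_proportion p \<le> 1 - 1 / (if p\<^sup>2 dvd n then real p else real p - 1)"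
    if "p \<in> prime_factors n" for p
  proof -
    have p: "prime p" "p dvd n" using that by auto
    show ?thesis
    proof (cases "p = 2")
      case True
      have "4 dvd n"
      proof (rule ccontr)
        assume "\<not> 4 dvd n"
        then have "n mod 4 = 2" using p True by presburger
        then show False using n by (simp add: cong_def)
      qed
      then show ?thesis using True by (simp add: local_proportion_def)
    next
      case False
      then have "p > 2" using prime_ge_2_nat[OF p(1)] by simp
      then show ?thesis by (simp add: local_proportion_def frac_le)
    qed
  qed
  then have "(\<Prod>p\<in>prime_factors n. local_proportion p) \<le> primitive_proportion n"
    unfolding primitive_proportion_eq[OF n0]
    using local_proportion_bounds(1) by (intro prod_mono) (auto intro: less_imp_le)
  moreover have "(\<Prod>p\<in>prime_factors n. local_proportion p) =
      (\<Prod>p\<in>A. local_proportion p) * (\<Prod>p\<in>B. local_proportion p)"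
  proof -
    have "prime_factors n = A \<union> B" by (auto simp: A_def B_def)
    moreover have "A \<inter> B = {}" by (auto simp: A_def B_def)
    ultimately show ?thesis using fin by (simp add: prod.union_disjoint)
  qed
  \<comment> \<open>Including the primes up to \<open>y\<close> that do not divide \<open>n\<close>
    only shrinks the product.\<close>
  moreover have "local_proportion_prod y \<le> (\<Prod>p\<in>A. local_proportion p)"
  proof -
    define P where "P = {p. p \<le> y \<and> prime p}"
    have "A \<subseteq> P" "finite P" by (auto simp: A_def P_def)
    then have "(\<Prod>p\<in>P. local_proportion p) =
        (\<Prod>p\<in>P - A. local_proportion p) * (\<Prod>p\<in>A. local_proportion p)"
      by (intro prod.subset_diff)
    also have "\<dots> \<le> 1 * (\<Prod>p\<in>A. local_proportion p)"
      using local_proportion_bounds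
      by (intro mult_right_mono prod_le_1 prod_nonneg) (auto simp: P_def A_def intro: less_imp_le)
    finally show ?thesis by (simp add: local_proportion_prod_def P_def)
  qed
  moreover have "1 - (real y + 1) / (real y * ln (real y)) \<le> (\<Prod>p\<in>B. local_proportion p)"
  proof -
    define k where "k = card B"
    have "y ^ k = (\<Prod>p\<in>B. y)" by (simp add: k_def)
    also have "\<dots> \<le> \<Prod>B" by (intro prod_mono) (auto simp: B_def)
    also have "\<dots> \<le> n"
      by (intro dvd_imp_le n0 prod_prime_factors_subset_dvd) (auto simp: B_def)
    finally have "real (y ^ k) \<le> real n" by (simp only: of_nat_le_iff)
    then have "ln (real (y ^ k)) \<le> ln (real n)" using y n0 by (subst ln_le_cancel_iff) auto
    then have "real k * ln (real y) \<le> ln (real n)" using y by (simp add: ln_realpow)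
    \<comment> \<open>The \<open>+ 1\<close> in the final bound is the loss from rounding
      \<open>ln n\<close> down to \<open>y\<close>.\<close>
    also have "ln (real n) \<le> real y + 1" unfolding y_def by linarith
    finally have "real k \<le> (real y + 1) / ln (real y)" using lny by (simp add: pos_le_divide_eq)
    then have "real k / real y \<le> (real y + 1) / ln (real y) / real y"
      by (rule divide_right_mono) simp
    then have "1 - (real y + 1) / (real y * ln (real y)) \<le> 1 + real k * (- 1 / real y)"
      by (simp add: mult.commute)
    \<comment> \<open>Bernoulli's inequality turns the bound on the number of large prime factors
      into a bound on their product.\<close>
    also have "\<dots> \<le> (1 + (- 1 / real y)) ^ k"
      using y by (intro Bernoulli_inequality) (simp add: field_simps)
    also have "\<dots> = (\<Prod>p\<in>B. 1 - 1 / real y)" by (simp add: k_def)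
    also have "\<dots> \<le> (\<Prod>p\<in>B. local_proportion p)"
    proof (rule prod_mono)
      fix p assume "p \<in> B"
      then have "p > y" by (simp add: B_def)
      then have "real y \<le> real p - 1" by simp
      then have "1 / (real p - 1) \<le> 1 / real y" using y by (intro frac_le) auto
      then show "0 \<le> 1 - 1 / real y \<and> 1 - 1 / real y \<le> local_proportion p"
        using \<open>p > y\<close> y by (simp add: local_proportion_def)
    qed
    finally show ?thesis .
  qed
  moreover have "0 \<le> local_proportion_prod y" "0 \<le> (\<Prod>p\<in>B. local_proportion p)"
    unfolding local_proportion_prod_def using local_proportion_bounds(1)
    by (auto intro!: prod_nonneg simp: B_def intro: less_imp_le)
  ultimately show ?thesis
    by (smt (verit) mult_left_mono mult_right_mono)
qed

section \<open>The extremal sequence\<close>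

text \<open>For \<open>x \<ge> 2\<close> the extra factor 2 makes the number divisible by 4, hence
  admissible, while odd primes still divide it only once.\<close>

definition twice_primorial :: "nat \<Rightarrow> nat" where
  "twice_primorial x = 2 * \<Prod>{p. p \<le> x \<and> prime p}"

lemma twice_primorial_remove:
  assumes "prime p" "p \<le> x"
  shows "twice_primorial x = p * (2 * \<Prod>({q. q \<le> x \<and> prime q} - {p}))"
proof -
  have "\<Prod>{q. q \<le> x \<and> prime q} = p * \<Prod>({q. q \<le> x \<and> prime q} - {p})"
    using assms by (intro prod.remove) auto
  then show ?thesis by (simp add: twice_primorial_def)
qed

lemma prime_dvd_prod_primes:
  fixes p :: nat
  assumes "prime p" "finite Q" "\<And>q. q \<in> Q \<Longrightarrow> prime q" "p dvd \<Prod>Q"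
  shows "p \<in> Q"
proof -
  obtain q where "q \<in> Q" "p dvd q" using assms by (auto simp: prime_dvd_prod_iff)
  then show ?thesis using assms primes_dvd_imp_eq[of p q] by auto
qed

lemma twice_primorial_gt_0: "twice_primorial x > 0"
  unfolding twice_primorial_def by (auto intro!: prod_pos prime_gt_0_nat)

lemma four_dvd_twice_primorial: "x \<ge> 2 \<Longrightarrow> 4 dvd twice_primorial x"
  by (subst twice_primorial_remove[of 2]) auto

lemma prime_factors_twice_primorial:
  assumes "x \<ge> 2"
  shows "prime_factors (twice_primorial x) = {p. p \<le> x \<and> prime p}"
proof (intro equalityI subsetI)
  fix p assume "p \<in> prime_factors (twice_primorial x)"
  then have p: "prime p" "p dvd twice_primorial x" by auto
  then have "p dvd 2 \<or> p dvd \<Prod>{p. p \<le> x \<and> prime p}"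
    by (simp add: twice_primorial_def prime_dvd_mult_iff)
  then show "p \<in> {p. p \<le> x \<and> prime p}"
  proof
    assume "p dvd 2"
    then show ?thesis using p assms by (auto dest: dvd_imp_le)
  next
    assume "p dvd \<Prod>{p. p \<le> x \<and> prime p}"
    then show ?thesis using p by (intro prime_dvd_prod_primes) auto
  qed
next
  fix p assume "p \<in> {p. p \<le> x \<and> prime p}"
  then show "p \<in> prime_factors (twice_primorial x)"
    using twice_primorial_remove[of p x] twice_primorial_gt_0[of x] by (auto simp: prime_factors_dvd)
qed

text \<open>Every prime up to \<open>x\<close> contributes its minimal factor: 2 occurs squared and
  each odd prime once.\<close>

lemma primitive_proportion_twice_primorial:
  assumes x: "x \<ge> 2"
  shows "primitive_proportion (twice_primorial x) = local_proportion_prod x"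
proof -
  have "1 - 1 / (if p\<^sup>2 dvd twice_primorial x then real p else real p - 1) = local_proportion p"
    if "p \<le> x" "prime p" for p
  proof (cases "p = 2")
    case True
    then show ?thesis using four_dvd_twice_primorial[OF x] by (simp add: local_proportion_def)
  next
    case False
    have "\<not> p\<^sup>2 dvd twice_primorial x"
    proof
      assume "p\<^sup>2 dvd twice_primorial x"
      then have "p dvd 2 * \<Prod>({q. q \<le> x \<and> prime q} - {p})"
        using that prime_gt_0_nat[of p] by (simp add: twice_primorial_remove[of p] power2_eq_square)
      then have "p dvd 2 \<or> p dvd \<Prod>({q. q \<le> x \<and> prime q} - {p})"
        using that by (simp add: prime_dvd_mult_iff)
      moreover have "\<not> p dvd 2" using that False primes_dvd_imp_eq[of p 2] by auto
      moreover have "\<not> p dvd \<Prod>({q. q \<le> x \<and> prime q} - {p})"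
      proof
        assume "p dvd \<Prod>({q. q \<le> x \<and> prime q} - {p})"
        then have "p \<in> {q. q \<le> x \<and> prime q} - {p}"
          using that by (intro prime_dvd_prod_primes) auto
        then show False by simp
      qed
      ultimately show False by blast
    qed
    then show ?thesis using False by (simp add: local_proportion_def)
  qed
  then show ?thesis
    unfolding primitive_proportion_eq[OF twice_primorial_gt_0] prime_factors_twice_primorial[OF x]
      local_proportion_prod_def by (intro prod.cong) auto
qed

text \<open>At most \<open>x - 1\<close> numbers up to \<open>x\<close> are prime, and the extra 2
  is at most \<open>x\<close>. This crude bound suffices, as two logarithms reduce it to
  \<open>ln (x * ln x)\<close>, asymptotic to \<open>ln x\<close>.\<close>

lemma twice_primorial_le:
  assumes x: "x \<ge> 2"
  shows "twice_primorial x \<le> x ^ x"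
proof -
  have "\<Prod>{p. p \<le> x \<and> prime p} \<le> (\<Prod>p\<in>{p. p \<le> x \<and> prime p}. x)"
    by (intro prod_mono) auto
  also have "\<dots> = x ^ card {p. p \<le> x \<and> prime p}" by simp
  also have "\<dots> \<le> x ^ (x - 1)"
  proof (rule power_increasing)
    have "card {p. p \<le> x \<and> prime p} \<le> card {2..x}"
      by (intro card_mono) (auto dest: prime_ge_2_nat)
    then show "card {p. p \<le> x \<and> prime p} \<le> x - 1" using x by simp
  qed (use x in simp)
  finally have "twice_primorial x \<le> x * x ^ (x - 1)"
    unfolding twice_primorial_def using x by (intro mult_mono) auto
  also have "\<dots> = x ^ x" using x by (simp add: power_eq_if)
  finally show ?thesis .
qed

lemma filterlim_twice_primorial: "filterlim twice_primorial sequentially sequentially"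
  unfolding filterlim_at_top
proof
  fix Z :: nat
  obtain p where p: "prime p" "p > Z" using bigger_prime by blast
  show "eventually (\<lambda>x. Z \<le> twice_primorial x) sequentially"
    using eventually_ge_at_top[of p]
  proof eventually_elim
    case (elim x)
    have "p dvd twice_primorial x" using twice_primorial_remove[OF p(1) elim] by simp
    then have "p \<le> twice_primorial x" using twice_primorial_gt_0 dvd_imp_le by blast
    then show ?case using p by simp
  qed
qed

text \<open>Both inequalities use the limit of \<open>local_proportion_prod N * ln N\<close>: the
  lower bound takes \<open>N = \<lfloor>ln n\<rfloor>\<close>, the upper bound follows the
  subsequence \<open>twice_primorial\<close>.\<close>

theorem mainTheorem2:
  shows "Liminf (inf sequentially (principal {n. \<not> [n = 2] (mod 4)}))
           (\<lambda>n. ereal (primitive_proportion n * ln (ln (real n))))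
         = ereal (twin_prime_const * exp (- euler_mascheroni))"
proof -
  define F where "F = inf sequentially (principal {n::nat. \<not> [n = 2] (mod 4)})"
  define C where "C = twin_prime_const * exp (- euler_mascheroni :: real)"
  define f where "f = (\<lambda>n. primitive_proportion n * ln (ln (real n)))"
  define G where "G = local_proportion_prod"
  have G: "(\<lambda>N. G N * ln (real N)) \<longlonglongrightarrow> C"
    unfolding G_def C_def by (rule local_proportion_prod_asymp)
  have "ereal C \<le> Liminf F (\<lambda>n. ereal (f n))"
    unfolding le_Liminf_iff
  proof (intro allI impI)
    fix c assume "c < ereal C"
    then obtain r where r: "c < ereal r" "r < C" using ereal_dense2 by force
    define H where "H = (\<lambda>y. G y * ln (real y) * (1 - (real y + 1) / (real y * ln (real y))))"
    \<comment> \<open>The loss from the prime factors above \<open>y\<close> is of order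
      \<open>1 / ln y\<close>, so it disappears in the limit.\<close>
    have "(\<lambda>y. 1 - (real y + 1) / (real y * ln (real y))) \<longlonglongrightarrow> 1" by real_asymp
    then have "H \<longlonglongrightarrow> C" unfolding H_def using tendsto_mult[OF G] by force
    then have "eventually (\<lambda>y. r < H y) sequentially" using r(2) by (rule order_tendstoD)
    moreover have lim: "filterlim (\<lambda>n. nat \<lfloor>ln (real n)\<rfloor>) sequentially sequentially" by real_asymp
    ultimately have "eventually (\<lambda>n. r < H (nat \<lfloor>ln (real n)\<rfloor>)) sequentially"
      by (rule eventually_compose_filterlim)
    moreover have "eventually (\<lambda>n. nat \<lfloor>ln (real n)\<rfloor> \<ge> 2) sequentially"
      using lim unfolding filterlim_at_top by blast
    ultimately have "eventually (\<lambda>n. \<not> [n = 2] (mod 4) \<longrightarrow> r < f n) sequentially"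
    proof eventually_elim
      case (elim n)
      define y where "y = nat \<lfloor>ln (real n)\<rfloor>"
      have y: "y \<ge> 2" using elim by (simp add: y_def)
      have "real y \<le> ln (real n)" using y unfolding y_def by linarith
      \<comment> \<open>Rounding \<open>ln n\<close> down only lowers the bound, because the
        proportion is nonnegative.\<close>
      then have le: "ln (real y) \<le> ln (ln (real n))" using y by (subst ln_le_cancel_iff) auto
      have ly: "ln (real y) \<ge> 0" using y by simp
      have rho: "primitive_proportion n \<ge> 0" by (simp add: primitive_proportion_def)
      show ?case
      proof
        assume n: "\<not> [n = 2] (mod 4)"
        have "r < H y" using elim by (simp add: y_def)
        also have "H y = G y * (1 - (real y + 1) / (real y * ln (real y))) * ln (real y)"
          by (simp add: H_def)
        also have "\<dots> \<le> primitive_proportion n * ln (real y)"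
          unfolding G_def using primitive_proportion_ge[OF n] y ly
          by (intro mult_right_mono) (simp_all add: y_def)
        also have "\<dots> \<le> f n" unfolding f_def using le rho by (rule mult_left_mono)
        finally show "r < f n" .
      qed
    qed
    then have "eventually (\<lambda>n. r < f n) F" by (simp add: F_def eventually_inf_principal)
    then show "eventually (\<lambda>n. c < ereal (f n)) F"
      by eventually_elim (use r(1) in \<open>auto intro: less_trans\<close>)
  qed
  moreover have "Liminf F (\<lambda>n. ereal (f n)) \<le> ereal C"
  proof (rule ccontr)
    assume "\<not> Liminf F (\<lambda>n. ereal (f n)) \<le> ereal C"
    then have "ereal C < Liminf F (\<lambda>n. ereal (f n))" by (simp only: not_le)
    then obtain r where "ereal C < ereal r" and rL: "ereal r < Liminf F (\<lambda>n. ereal (f n))"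
      using ereal_dense2 by blast
    then have rC: "C < r" by simp
    have "eventually (\<lambda>n. ereal r < ereal (f n)) F" using rL by (rule less_LiminfD)
    then have ev: "eventually (\<lambda>n. r < f n) F" by simp
    have "filterlim twice_primorial F sequentially"
      unfolding F_def filterlim_inf filterlim_principal
    proof
      show "filterlim twice_primorial sequentially sequentially" by (rule filterlim_twice_primorial)
      show "eventually (\<lambda>x. twice_primorial x \<in> {n. \<not> [n = 2] (mod 4)}) sequentially"
        using eventually_ge_at_top[of 2]
      proof eventually_elim
        case (elim x)
        have "twice_primorial x mod 4 = 0" using four_dvd_twice_primorial[OF elim] by presburger
        then show ?case by (simp add: cong_def)
      qed
    qed
    with ev have ev1: "eventually (\<lambda>x. r < f (twice_primorial x)) sequentially"
      by (rule eventually_compose_filterlim)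
    \<comment> \<open>With \<open>m = twice_primorial x \<le> x ^ x\<close>,
      \<open>ln (ln m)\<close> exceeds \<open>ln x\<close> by at most a factor tending to 1; an
      \<open>r\<close> above \<open>C\<close> therefore cannot stay below \<open>f\<close> along
      this sequence.\<close>
    have "(\<lambda>x::nat. ln (real x * ln (real x)) / ln (real x)) \<longlonglongrightarrow> 1" by real_asymp
    then have "(\<lambda>x. G x * ln (real x) * (ln (real x * ln (real x)) / ln (real x))) \<longlonglongrightarrow> C"
      using tendsto_mult[OF G] by force
    then have "eventually (\<lambda>x. G x * ln (real x) * (ln (real x * ln (real x)) / ln (real x)) < r) sequentially"
      using rC by (rule order_tendstoD)
    with ev1 have "eventually (\<lambda>x. False) sequentially" using eventually_ge_at_top[of 2]
    proof eventually_elim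
      case (elim x)
      define m where "m = twice_primorial x"
      have x: "x \<ge> 2" using elim by simp
      have "4 dvd m" "m > 0" using four_dvd_twice_primorial[OF x] twice_primorial_gt_0 by (auto simp: m_def)
      then have m: "m \<ge> 4" by (simp add: dvd_imp_le)
      have "real m \<le> real (x ^ x)" unfolding m_def of_nat_le_iff by (rule twice_primorial_le[OF x])
      then have "ln (real m) \<le> ln (real (x ^ x))" using m x by (subst ln_le_cancel_iff) auto
      then have "ln (real m) \<le> real x * ln (real x)" using x by (simp add: ln_realpow)
      then have "ln (ln (real m)) \<le> ln (real x * ln (real x))" using m x by (subst ln_le_cancel_iff) auto
      moreover have "G x \<ge> 0" unfolding G_def local_proportion_prod_def
        using local_proportion_bounds(1) by (auto intro!: prod_nonneg intro: less_imp_le)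
      ultimately have "f m \<le> G x * ln (real x * ln (real x))"
        unfolding f_def m_def primitive_proportion_twice_primorial[OF x] G_def
        by (intro mult_left_mono)
      also have "\<dots> = G x * ln (real x) * (ln (real x * ln (real x)) / ln (real x))" using x by simp
      finally show False using elim by (simp add: m_def)
    qed
    then show False by simp
  qed
  ultimately show ?thesis unfolding F_def f_def C_def by (rule antisym [rotated])
qed

end
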